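(* There exist constants $n_0$ and $C$ such that for every $n>n_0$ and $\varepsilon>0$ there exists a function $f\colon\mathbb{F}_2^n\to\mathbb{F}_2$ which is an affine extractor for dimension $k$ with bias $\varepsilon$, where $k=\log(n/\varepsilon^2)+\log\log(n/\varepsilon^2)+O(1)$, and moreover: (1) $\deg(f)=\log(n/\varepsilon^2)+\log\log(n/\varepsilon^2)+O(1)$; (2) $f$ can be computed by a depth-3 XOR–AND–XOR circuit of size $O((n/\varepsilon)^2\cdot\log^3(n/\varepsilon))$; (3) $f$ can be computed by a De Morgan formula of size $O((n^5/\varepsilon^2)\cdot\log^3(n/\varepsilon))$.
   Context: Here $f\colon\mathbb{F}_2^n\to\mathbb{F}_2$ is an affine extractor for dimension $k$ with bias $\varepsilon$ if for every affine subspace $u_0+U\subseteq\mathbb{F}_2^n$ of dimension $k$, $\big|2^{-k}\sum_{u\in u_0+U}(-1)^{f(u)}\big|<\varepsilon$. An XOR–AND–XOR circuit has inputs $x_1,\dots,x_n$ (and constants), a bottom layer of unbounded fan-in XOR gates, a middle layer of unbounded fan-in AND gates and a single top unbounded fan-in XOR gate; size is the number of gates. A De Morgan formula is a formula over literals with AND and OR gates of fan-in at most 2, each gate of fan-out 1; size is the number of leaves/gates. Logarithms are to base 2; the $O(\cdot)$ constants are universal.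
   Formalization: Assumes n/ε² ≥ 2, since loglog(n/ε²) is undefined for n/ε² ≤ 1 and tends to −∞ near 1; the lower bound in deg(f)=log(n/ε²)+loglog(n/ε²)+O(1) is claimed only when log(n/ε²)+loglog(n/ε²) ≤ n, since deg(f) ≤ n makes it false for tiny ε. *)

theory Defs
  imports Complex_Main "HOL-Library.Z2" "HOL-Library.Function_Algebras"
begin

declare add_bit_eq_xor [simp del] mult_bit_eq_and [simp del]

(* The ambient space F_2^n: bit sequences supported on the first n coordinates (so the
   coordinates are x 0, ..., x (n - 1)), inside the F_2-vector space of all bit sequences
   with the pointwise operations of Function_Algebras. *)

definition cube :: "nat \<Rightarrow> (nat \<Rightarrow> bit) set" where
  "cube n = {x. \<forall>i\<ge>n. x i = 0}"

definition bscale :: "bit \<Rightarrow> (nat \<Rightarrow> bit) \<Rightarrow> nat \<Rightarrow> bit" where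
  "bscale c x = (\<lambda>i. c * x i)"

global_interpretation F2: vector_space bscale
  by standard (auto simp: bscale_def fun_eq_iff algebra_simps)

definition affine_subspace :: "nat \<Rightarrow> nat \<Rightarrow> (nat \<Rightarrow> bit) set \<Rightarrow> bool" where
  "affine_subspace n k W \<longleftrightarrow>
     (\<exists>u0 U. u0 \<in> cube n \<and> U \<subseteq> cube n \<and> F2.subspace U \<and> F2.dim U = k \<and> W = (\<lambda>u. u0 + u) ` U)"

definition bit_sign :: "bit \<Rightarrow> real" where
  "bit_sign b = (-1) ^ (if b = 1 then 1 else 0)"

(* Functions F_2^n -> F_2 are represented by functions on all bit sequences; everything
   below depends only on their values on cube n. *)

definition affine_extractor :: "nat \<Rightarrow> nat \<Rightarrow> real \<Rightarrow> ((nat \<Rightarrow> bit) \<Rightarrow> bit) \<Rightarrow> bool" where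
  "affine_extractor n k \<epsilon> f \<longleftrightarrow>
     (\<forall>W. affine_subspace n k W \<longrightarrow> \<bar>(\<Sum>u\<in>W. bit_sign (f u)) / 2 ^ k\<bar> < \<epsilon>)"

(* A multilinear polynomial in x 0, ..., x (n - 1) is given by its coefficients: c S is the
   coefficient of the monomial prod_{i in S} x_i. *)

definition multilinear_eval :: "nat \<Rightarrow> (nat set \<Rightarrow> bit) \<Rightarrow> (nat \<Rightarrow> bit) \<Rightarrow> bit" where
  "multilinear_eval n c x = (\<Sum>S\<in>Pow {..<n}. c S * (\<Prod>i\<in>S. x i))"

definition represents :: "nat \<Rightarrow> (nat set \<Rightarrow> bit) \<Rightarrow> ((nat \<Rightarrow> bit) \<Rightarrow> bit) \<Rightarrow> bool" where
  "represents n c f \<longleftrightarrow>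
     (\<forall>S. \<not> S \<subseteq> {..<n} \<longrightarrow> c S = 0) \<and> (\<forall>x\<in>cube n. f x = multilinear_eval n c x)"

lemma represents_exists: "\<exists>c. represents n c f"
proof (induction n arbitrary: f)
  case 0
  have "x = 0" if "x \<in> cube 0" for x
    using that by (auto simp: cube_def fun_eq_iff)
  then have "represents 0 (\<lambda>S. if S = {} then f 0 else 0) f"
    by (auto simp: represents_def multilinear_eval_def)
  then show ?case by blast
next
  case (Suc n)
  obtain a where a: "represents n a f" using Suc by blast
  obtain b where b: "represents n b (\<lambda>x. f x + f (x(n := 1)))" using Suc by blast
  define c where "c S = (if n \<in> S then b (S - {n}) else a S)" for S
  have supp: "c S = 0" if S: "\<not> S \<subseteq> {..<Suc n}" for S
  proof -
    from S obtain i where "i \<in> S" "i \<ge> Suc n" using not_less by blast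
    then have "\<not> S \<subseteq> {..<n}" "\<not> S - {n} \<subseteq> {..<n}" by auto
    then show ?thesis using a b by (simp add: represents_def c_def)
  qed
  have val: "f x = multilinear_eval (Suc n) c x" if x: "x \<in> cube (Suc n)" for x
  proof -
    define y where "y = x(n := 0)"
    have y: "y \<in> cube n"
      using x by (auto simp: cube_def y_def le_Suc_eq)
    have prod_eq: "(\<Prod>i\<in>S. x i) = (\<Prod>i\<in>S. y i)" if "S \<subseteq> {..<n}" for S
      by (rule prod.cong) (use that in \<open>auto simp: y_def\<close>)
    have P: "Pow {..<Suc n} = Pow {..<n} \<union> insert n ` Pow {..<n}"
      by (simp add: lessThan_Suc Pow_insert)
    have inj: "inj_on (insert n) (Pow {..<n})"
      by (auto intro!: inj_onI simp: insert_eq_iff)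
    have "multilinear_eval (Suc n) c x
        = (\<Sum>S\<in>Pow {..<n}. c S * (\<Prod>i\<in>S. x i))
          + (\<Sum>S\<in>insert n ` Pow {..<n}. c S * (\<Prod>i\<in>S. x i))"
      unfolding multilinear_eval_def P by (rule sum.union_disjoint) auto
    also have "(\<Sum>S\<in>insert n ` Pow {..<n}. c S * (\<Prod>i\<in>S. x i))
        = (\<Sum>S\<in>Pow {..<n}. x n * (b S * (\<Prod>i\<in>S. y i)))"
      unfolding sum.reindex[OF inj] o_def
    proof (rule sum.cong[OF refl])
      fix S assume S: "S \<in> Pow {..<n}"
      then have "n \<notin> S" "finite S" by (auto intro: finite_subset)
      then show "c (insert n S) * (\<Prod>i\<in>insert n S. x i) = x n * (b S * (\<Prod>i\<in>S. y i))"
        using S prod_eq[of S] by (simp add: c_def mult.left_commute)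
    qed
    also have "\<dots> = x n * multilinear_eval n b y"
      by (simp add: multilinear_eval_def sum_distrib_left)
    also have "(\<Sum>S\<in>Pow {..<n}. c S * (\<Prod>i\<in>S. x i)) = multilinear_eval n a y"
      unfolding multilinear_eval_def
      by (rule sum.cong) (auto simp: c_def prod_eq)
    finally have "multilinear_eval (Suc n) c x = f y + x n * (f y + f (y(n := 1)))"
      using a b y by (simp add: represents_def)
    moreover have "x n = 0 \<Longrightarrow> y = x" "x n = 1 \<Longrightarrow> y(n := 1) = x"
      by (auto simp: y_def fun_eq_iff)
    ultimately show ?thesis
      by (cases "x n"; cases "f y") auto
  qed
  have "represents (Suc n) c f" using supp val by (simp add: represents_def)
  then show ?case by blast
qed

lemma represents_unique:
  assumes "represents n c f" "represents n d f"
  shows "c = d"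
proof -
  have "c S = d S" if "finite S" for S
    using that
  proof (induction S rule: finite_psubset_induct)
    case (psubset S)
    show ?case
    proof (cases "S \<subseteq> {..<n}")
      case False
      then show ?thesis using assms by (simp add: represents_def)
    next
      case True
      define x :: "nat \<Rightarrow> bit" where "x = (\<lambda>i. if i \<in> S then 1 else 0)"
      have x: "x \<in> cube n" using True by (auto simp: cube_def x_def)
      have pr: "(\<Prod>i\<in>T. x i) = (if T \<subseteq> S then 1 else 0)" if "T \<subseteq> {..<n}" for T
      proof -
        have "finite T" using that finite_subset by blast
        then show ?thesis by (induction T) (auto simp: x_def)
      qed
      have ev: "multilinear_eval n e x = e S + (\<Sum>T\<in>Pow S - {S}. e T)" for e
      proof -
        have "multilinear_eval n e x = (\<Sum>T\<in>Pow {..<n}. if T \<subseteq> S then e T else 0)"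
          unfolding multilinear_eval_def by (rule sum.cong) (auto simp: pr)
        also have "\<dots> = (\<Sum>T\<in>Pow S. e T)"
          by (rule sum.mono_neutral_cong_right) (use True in auto)
        also have "\<dots> = e S + (\<Sum>T\<in>Pow S - {S}. e T)"
          by (rule sum.remove) (use psubset.hyps in auto)
        finally show ?thesis .
      qed
      have "(\<Sum>T\<in>Pow S - {S}. c T) = (\<Sum>T\<in>Pow S - {S}. d T)"
        by (rule sum.cong) (use psubset.IH in auto)
      moreover have "multilinear_eval n c x = multilinear_eval n d x"
        using assms x by (simp add: represents_def)
      ultimately show ?thesis by (simp add: ev)
    qed
  qed
  moreover have "c S = d S" if "infinite S" for S
  proof -
    have "\<not> S \<subseteq> {..<n}" using that finite_subset by blast
    then show ?thesis using assms by (simp add: represents_def)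
  qed
  ultimately show ?thesis by blast
qed

lemma represents_ex1: "\<exists>!c. represents n c f"
  using represents_exists represents_unique by blast

definition anf :: "nat \<Rightarrow> ((nat \<Rightarrow> bit) \<Rightarrow> bit) \<Rightarrow> nat set \<Rightarrow> bit" where
  "anf n f = (THE c. represents n c f)"

(* The degree of the zero function is 0. *)
definition f2_degree :: "nat \<Rightarrow> ((nat \<Rightarrow> bit) \<Rightarrow> bit) \<Rightarrow> nat" where
  "f2_degree n f = Max (insert 0 (card ` {S \<in> Pow {..<n}. anf n f S \<noteq> 0}))"

(* XOR-AND-XOR circuits.  A bottom gate (A, b) has as input wires the variables x_i for
   i in A and, iff b = 1, the constant 1; it computes their XOR.  An AND gate is given by the
   set of (indices of) bottom gates feeding it, and the single top XOR gate by the set of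
   (indices of) AND gates feeding it. *)

datatype xax_circuit =
  XAX (xor_gates: "(nat set \<times> bit) list") (and_gates: "nat set list") (top_gate: "nat set")

fun xax_wf :: "nat \<Rightarrow> xax_circuit \<Rightarrow> bool" where
  "xax_wf n (XAX bs ms t) \<longleftrightarrow>
     (\<forall>(A, b)\<in>set bs. A \<subseteq> {..<n}) \<and>
     (\<forall>M\<in>set ms. M \<subseteq> {..<length bs}) \<and>
     t \<subseteq> {..<length ms}"

definition xor_gate_eval :: "nat set \<times> bit \<Rightarrow> (nat \<Rightarrow> bit) \<Rightarrow> bit" where
  "xor_gate_eval g x = (\<Sum>i\<in>fst g. x i) + snd g"

fun xax_eval :: "xax_circuit \<Rightarrow> (nat \<Rightarrow> bit) \<Rightarrow> bit" where
  "xax_eval (XAX bs ms t) x = (\<Sum>j\<in>t. \<Prod>l\<in>ms ! j. xor_gate_eval (bs ! l) x)"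

fun xax_size :: "xax_circuit \<Rightarrow> nat" where
  "xax_size (XAX bs ms t) = length bs + length ms + 1"

definition xax_computes :: "nat \<Rightarrow> xax_circuit \<Rightarrow> ((nat \<Rightarrow> bit) \<Rightarrow> bit) \<Rightarrow> bool" where
  "xax_computes n K f \<longleftrightarrow> xax_wf n K \<and> (\<forall>x\<in>cube n. xax_eval K x = f x)"

(* De Morgan formulas: DLit True i is the literal x_i, DLit False i its negation. *)

datatype dm_formula = DLit bool nat | DAnd dm_formula dm_formula | DOr dm_formula dm_formula

primrec dm_vars :: "dm_formula \<Rightarrow> nat set" where
  "dm_vars (DLit s i) = {i}"
| "dm_vars (DAnd F G) = dm_vars F \<union> dm_vars G"
| "dm_vars (DOr F G) = dm_vars F \<union> dm_vars G"

primrec dm_eval :: "dm_formula \<Rightarrow> (nat \<Rightarrow> bit) \<Rightarrow> bool" where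
  "dm_eval (DLit s i) x \<longleftrightarrow> (x i = 1) = s"
| "dm_eval (DAnd F G) x \<longleftrightarrow> dm_eval F x \<and> dm_eval G x"
| "dm_eval (DOr F G) x \<longleftrightarrow> dm_eval F x \<or> dm_eval G x"

(* Number of leaves; the number of AND and OR gates is one less. *)
primrec dm_size :: "dm_formula \<Rightarrow> nat" where
  "dm_size (DLit s i) = 1"
| "dm_size (DAnd F G) = dm_size F + dm_size G"
| "dm_size (DOr F G) = dm_size F + dm_size G"

definition dm_computes :: "nat \<Rightarrow> dm_formula \<Rightarrow> ((nat \<Rightarrow> bit) \<Rightarrow> bit) \<Rightarrow> bool" where
  "dm_computes n F f \<longleftrightarrow> dm_vars F \<subseteq> {..<n} \<and> (\<forall>x\<in>cube n. dm_eval F x \<longleftrightarrow> f x = 1)"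

definition ext_dim :: "nat \<Rightarrow> real \<Rightarrow> real" where
  "ext_dim n \<epsilon> = log 2 (real n / \<epsilon>\<^sup>2) + log 2 (log 2 (real n / \<epsilon>\<^sup>2))"

end

theory Submission
  imports Defs
begin

text \<open>
  The extractor is an XOR of about \<open>n k\<close> independent random blocks, each of them a uniformly
  random truth table on \<open>k\<close> bits composed with a uniformly random linear map
  \<open>L : F_2^n \<rightarrow> F_2^k\<close>. Fix an affine subspace \<open>W\<close> of dimension \<open>k\<close> and expand the
  \<open>2t\<close>-th moment of the character sum over \<open>W\<close>, \<open>t = n k\<close>, as a sum over \<open>2t\<close>-tuples of
  points. At most \<open>(2t |W|)^t\<close> tuples contain every point an even number of times. In any other
  tuple some point \<open>x0\<close> occurs an odd number of times, and the expectation over the truth table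
  of a single block vanishes unless \<open>L\<close> maps another point of the tuple to \<open>L x0\<close>, which has
  probability at most \<open>2t / 2^k\<close>; since the blocks are independent, such a tuple contributes at
  most \<open>(2t / 2^k)^t\<close>. With \<open>2^k \<ge> 32 n k / \<epsilon>^2\<close>, Markov's inequality gives a failure
  probability of at most \<open>2 / 16^t\<close> for \<open>W\<close>, which survives the union bound over the at most
  \<open>2^(n (k + 1))\<close> subspaces.

  The union bound also covers the function with the monomial \<open>x_0 \<dots> x_{k-1}\<close> added; one of the
  two functions has that monomial in its algebraic normal form, and hence degree exactly \<open>k\<close>.
  A truth table on \<open>k\<close> bits is an XOR of at most \<open>2^k\<close> ANDs of \<open>k\<close> affine forms, which
  gives the circuit. As a formula, a block is a decision tree that queries \<open>k\<close> parities, and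
  a balanced formula for the XOR of the \<open>O(n k)\<close> blocks costs a further factor \<open>O((n k)^2)\<close>.
\<close>

section \<open>Moments and words\<close>

definition words :: "'a set \<Rightarrow> nat \<Rightarrow> 'a list set" where
  "words A m = {xs. set xs \<subseteq> A \<and> length xs = m}"

lemma finite_words: "finite A \<Longrightarrow> finite (words A m)"
  by (simp add: words_def finite_lists_length_eq)

lemma card_words: "finite A \<Longrightarrow> card (words A m) = card A ^ m"
  by (simp add: words_def card_lists_length_eq)

lemma words_0: "words A 0 = {[]}"
  by (auto simp: words_def)

lemma words_Suc: "words A (Suc m) = (\<lambda>(x, xs). x # xs) ` (A \<times> words A m)"
  by (auto simp: words_def length_Suc_conv image_iff)

text \<open>Applied to points, this opens a moment into tuples; applied to blocks, it expresses the
  independence of the blocks.\<close>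

lemma power_sum_words:
  fixes h :: "'a \<Rightarrow> 'b::comm_semiring_1"
  shows "(\<Sum>x\<in>A. h x) ^ m = (\<Sum>xs\<in>words A m. prod_list (map h xs))"
proof (induction m)
  case (Suc m)
  have inj: "inj_on (\<lambda>(x, xs). x # xs) (A \<times> words A m)"
    by (auto simp: inj_on_def)
  show ?case
    by (subst words_Suc, subst sum.reindex[OF inj])
      (simp add: Suc sum_product sum.cartesian_product case_prod_unfold)
qed (simp add: words_0)

lemma prod_list_swap:
  fixes \<phi> :: "'a \<Rightarrow> 'b \<Rightarrow> 'c::comm_monoid_mult"
  shows "prod_list (map (\<lambda>x. prod_list (map (\<lambda>w. \<phi> w x) ws)) xs)
    = prod_list (map (\<lambda>w. prod_list (map (\<phi> w) xs)) ws)"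
proof (induction xs)
  case Nil
  then show ?case by (induction ws) auto
next
  case (Cons x xs)
  have "prod_list (map (\<lambda>w. f w * g w) ws) = prod_list (map f ws) * prod_list (map g ws)" for f g :: "'a \<Rightarrow> 'c"
    by (induction ws) (auto simp: algebra_simps)
  then show ?case using Cons by simp
qed

lemma abs_prod_list_le_1:
  fixes h :: "'a \<Rightarrow> real"
  assumes "\<And>x. \<bar>h x\<bar> \<le> 1"
  shows "\<bar>prod_list (map h xs)\<bar> \<le> 1"
  by (induction xs) (auto simp: abs_mult assms intro!: mult_le_one)

text \<open>These are exactly the tuples whose product of signs is 1 for every function to
  bits.\<close>

definition even_words :: "'a set \<Rightarrow> nat \<Rightarrow> 'a list set" where
  "even_words A m = {xs \<in> words A m. \<forall>y. even (count_list xs y)}"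

text \<open>Every even word arises by matching the positions in pairs and choosing a letter for each
  pair; there are at most \<open>(2 * t) ^ t\<close> matchings.\<close>

lemma card_even_words:
  assumes "finite A"
  shows "card (even_words A (2 * t)) \<le> (2 * t * card A) ^ t"
proof (induction t)
  case 0
  have "even_words A (2 * 0) = {[]}" by (auto simp: even_words_def words_0)
  then show ?case by simp
next
  case (Suc t)
  \<comment> \<open>The head of an even word recurs later; removing both occurrences leaves an even word.\<close>
  let ?ins = "\<lambda>(x, j, zs). x # take j zs @ x # drop j zs"
  let ?P = "A \<times> {..2 * t} \<times> even_words A (2 * t)"
  have fin: "finite ?P"
    using assms by (auto simp: even_words_def finite_words)
  have "even_words A (2 * Suc t) \<subseteq> ?ins ` ?P"
  proof
    fix xs assume xs: "xs \<in> even_words A (2 * Suc t)"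
    then obtain x ys where x: "xs = x # ys" "length ys = Suc (2 * t)"
      by (auto simp: even_words_def words_def length_Suc_conv)
    have "odd (count_list ys x)"
      using xs x(1) by (auto simp: even_words_def dest: spec[of _ x])
    then have "x \<in> set ys"
      using count_notin by fastforce
    then obtain as bs where ys: "ys = as @ x # bs"
      by (auto simp: in_set_conv_decomp)
    have e: "even (count_list (as @ bs) y)" for y
    proof -
      have "even (count_list xs y)" using xs by (simp add: even_words_def)
      then show ?thesis by (auto simp: x ys split: if_splits)
    qed
    then have "as @ bs \<in> even_words A (2 * t)"
      using xs x ys by (auto simp: even_words_def words_def)
    then have "(x, length as, as @ bs) \<in> ?P"
      using xs x ys by (auto simp: even_words_def words_def)
    moreover have "xs = ?ins (x, length as, as @ bs)"
      by (simp add: x ys)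
    ultimately show "xs \<in> ?ins ` ?P" by (rule rev_image_eqI)
  qed
  then have "card (even_words A (2 * Suc t)) \<le> card ?P"
    using fin by (meson card_image_le card_mono finite_imageI le_trans)
  also have "\<dots> = card A * (Suc (2 * t) * card (even_words A (2 * t)))"
    by (simp add: card_cartesian_product)
  also have "\<dots> \<le> card A * (2 * Suc t * (2 * Suc t * card A) ^ t)"
  proof -
    have "(2 * t * card A) ^ t \<le> (2 * Suc t * card A) ^ t"
      by (intro power_mono mult_le_mono1) auto
    then have "card (even_words A (2 * t)) \<le> (2 * Suc t * card A) ^ t"
      using Suc by linarith
    then show ?thesis
      by (intro mult_le_mono) auto
  qed
  also have "\<dots> = (2 * Suc t * card A) ^ Suc t"
    by (simp add: algebra_simps)
  finally show ?case .
qed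

section \<open>The bias of random blocks\<close>

lemma bit_sign_simps [simp]: "bit_sign 0 = 1" "bit_sign 1 = -1" "\<bar>bit_sign b\<bar> = 1"
  by (auto simp: bit_sign_def)

lemma bit_sign_add: "bit_sign (a + b) = bit_sign a * bit_sign b"
  by (cases a; cases b) auto

text \<open>Toggling \<open>v\<close> in the truth table is an involution of \<open>Pow V\<close>
  that multiplies the product by an odd power of -1, so the terms cancel in pairs.\<close>

lemma sum_bit_sign_truth_tables_eq_0:
  assumes V: "finite V" "v \<in> V" and odd: "odd (count_list vs v)"
  shows "(\<Sum>G\<in>Pow V. prod_list (map (\<lambda>u. bit_sign (of_bool (u \<in> G))) vs)) = 0"
    (is "sum ?h _ = 0")
proof -
  define tog where "tog G = (if v \<in> G then G - {v} else insert v G)" for G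
  have tog: "tog (tog G) = G" and tog_subset: "G \<subseteq> V \<Longrightarrow> tog G \<subseteq> V" for G
    using V by (auto simp: tog_def)
  have flip: "?h (tog G) = - ?h G" for G
  proof -
    have "bit_sign (of_bool (u \<in> tog G)) = (if u = v then - 1 else 1) * bit_sign (of_bool (u \<in> G))" for u
      by (auto simp: tog_def)
    then have "?h (tog G) = (-1) ^ count_list vs v * ?h G"
      by (induction vs) (simp_all del: if_image_distrib)
    then show ?thesis using odd by simp
  qed
  have "sum ?h (Pow V) = (\<Sum>G\<in>Pow V. ?h (tog G))"
    by (rule sum.reindex_bij_witness[where i = tog and j = tog])
      (use V tog tog_subset in auto)
  also have "\<dots> = - sum ?h (Pow V)"
    by (simp only: flip sum_negf)
  finally show ?thesis by simp
qed

text \<open>A linear map is given by its rows, each row being the set of coordinates that it sums.\<close>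

definition lin :: "nat set list \<Rightarrow> (nat \<Rightarrow> bit) \<Rightarrow> bit list" where
  "lin L x = map (\<lambda>A. \<Sum>i\<in>A. x i) L"

lemma length_lin [simp]: "length (lin L x) = length L"
  by (simp add: lin_def)

lemma finite_bit_lists: "finite {v :: bit list. length v = s}"
  and card_bit_lists: "card {v :: bit list. length v = s} = 2 ^ s"
proof -
  have U: "(UNIV :: bit set) = {0, 1}"
    using bit_not_zero_iff by auto
  have e: "{v :: bit list. length v = s} = words UNIV s"
    by (auto simp: words_def)
  show "finite {v :: bit list. length v = s}" unfolding e
    by (rule finite_words) (simp add: U)
  show "card {v :: bit list. length v = s} = 2 ^ s" unfolding e
    by (subst card_words) (simp_all add: U numeral_2_eq_2)
qed

text \<open>If \<open>x j \<noteq> y j\<close>, toggling \<open>j\<close> in a row exchanges the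
  rows that identify \<open>x\<close> and \<open>y\<close> with those that separate them.\<close>

lemma card_separating_rows:
  assumes x: "x \<in> cube n" "y \<in> cube n" "x \<noteq> y"
  shows "2 * card {A \<in> Pow {..<n}. (\<Sum>i\<in>A. x i) = (\<Sum>i\<in>A. y i)} = 2 ^ n"
proof -
  obtain j where j: "x j \<noteq> y j" using x by auto
  then have jn: "j < n" using x by (auto simp: cube_def not_less[symmetric])
  let ?E = "\<lambda>A. (\<Sum>i\<in>A. x i) = (\<Sum>i\<in>A. y i)"
  let ?P = "{A \<in> Pow {..<n}. ?E A}" and ?Q = "{A \<in> Pow {..<n}. \<not> ?E A}"
  let ?tog = "\<lambda>A. if j \<in> A then A - {j} else insert j A"
  have ins: "?E (insert j A) \<longleftrightarrow> \<not> ?E A" if "j \<notin> A" "A \<subseteq> {..<n}" for A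
  proof -
    have "finite A" using that finite_subset by blast
    then show ?thesis using that j
      by (simp) (cases "x j"; cases "y j"; cases "sum x A"; cases "sum y A"; simp)
  qed
  have flip: "?E (?tog A) \<longleftrightarrow> \<not> ?E A" if "A \<subseteq> {..<n}" for A
  proof (cases "j \<in> A")
    case True
    then have "insert j (A - {j}) = A" by auto
    then show ?thesis using ins[of "A - {j}"] that True by auto
  next
    case False
    then show ?thesis using ins[of A] that by auto
  qed
  have "bij_betw ?tog ?P ?Q"
  proof (rule bij_betw_byWitness[where f' = ?tog])
    have sub: "?tog A \<subseteq> {..<n} \<longleftrightarrow> A \<subseteq> {..<n}" for A using jn by auto
    show "?tog ` ?P \<subseteq> ?Q" "?tog ` ?Q \<subseteq> ?P"
      unfolding image_subset_iff mem_Collect_eq Pow_iff using flip sub by blast+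
  qed auto
  then have "card ?P = card ?Q" by (rule bij_betw_same_card)
  moreover have "card (Pow {..<n}) = card ?P + card ?Q"
  proof -
    have "card (?P \<union> ?Q) = card ?P + card ?Q"
      by (rule card_Un_disjoint) auto
    moreover have "?P \<union> ?Q = Pow {..<n}" by auto
    ultimately show ?thesis by simp
  qed
  ultimately show ?thesis by (simp add: card_Pow)
qed

text \<open>A collision requires each of the \<open>s\<close> independent rows to identify the two
  points, which has probability exactly 1/2 per row.\<close>

lemma card_lin_collision:
  assumes x: "x \<in> cube n" "y \<in> cube n" "x \<noteq> y"
  shows "2 ^ s * card {L \<in> words (Pow {..<n}) s. lin L x = lin L y}
    = card (words (Pow {..<n}) s)"
proof -
  let ?P = "{A \<in> Pow {..<n}. (\<Sum>i\<in>A. x i) = (\<Sum>i\<in>A. y i)}"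
  have "{L \<in> words (Pow {..<n}) s. lin L x = lin L y} = words ?P s"
    by (auto simp: words_def lin_def)
  then show ?thesis
    by (simp add: card_words card_Pow card_separating_rows[OF x, symmetric] power_mult_distrib)
qed

text \<open>The uniform sample space of one block. Expectations are written as sums over it, so a
  factor \<open>card (blocks n s)\<close> stands for each normalisation.\<close>

definition blocks :: "nat \<Rightarrow> nat \<Rightarrow> (nat set list \<times> bit list set) set" where
  "blocks n s = words (Pow {..<n}) s \<times> Pow {v. length v = s}"

text \<open>The second component of a block is the set of inputs on which its truth table is 1.\<close>

definition block_fun :: "nat set list \<times> bit list set \<Rightarrow> (nat \<Rightarrow> bit) \<Rightarrow> bit" where
  "block_fun w x = of_bool (lin (fst w) x \<in> snd w)"

definition xor_blocks :: "(nat set list \<times> bit list set) list \<Rightarrow> (nat \<Rightarrow> bit) \<Rightarrow> bit" where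
  "xor_blocks ws x = sum_list (map (\<lambda>w. block_fun w x) ws)"

lemma finite_blocks: "finite (blocks n s)"
  by (simp add: blocks_def finite_words finite_bit_lists)

lemma blocks_nonempty: "blocks n s \<noteq> {}"
proof -
  have "(replicate s {}, {}) \<in> blocks n s"
    by (auto simp: blocks_def words_def)
  then show ?thesis by blast
qed

lemma bit_sign_xor_blocks:
  "bit_sign (xor_blocks ws x) = prod_list (map (\<lambda>w. bit_sign (block_fun w x)) ws)"
  by (induction ws) (auto simp: xor_blocks_def bit_sign_add)

lemma count_list_map_eq:
  assumes "\<And>y. y \<in> set xs \<Longrightarrow> f y = f x \<Longrightarrow> y = x"
  shows "count_list (map f xs) (f x) = count_list xs x"
  using assms by (induction xs) auto

text \<open>For a linear map that sends no other point of the tuple to the image of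
  \<open>x0\<close>, that image has odd multiplicity and the sum over truth tables vanishes. The
  remaining maps are counted by a union bound over the points of the tuple.\<close>

lemma block_bias:
  assumes xs: "xs \<in> words (cube n) m" and odd: "odd (count_list xs x0)"
  shows "2 ^ s * \<bar>\<Sum>w\<in>blocks n s. prod_list (map (\<lambda>x. bit_sign (block_fun w x)) xs)\<bar>
    \<le> real m * real (card (blocks n s))"
proof -
  define \<L> where "\<L> = words (Pow {..<n}) s"
  define V where "V = {v :: bit list. length v = s}"
  define T where "T L = (\<Sum>G\<in>Pow V. prod_list (map (\<lambda>x. bit_sign (block_fun (L, G) x)) xs))" for L
  define coll where "coll y = {L \<in> \<L>. lin L y = lin L x0}" for y
  define Y where "Y = set xs - {x0}"
  have fin: "finite \<L>" "finite V" "finite Y"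
    by (simp_all add: \<L>_def V_def Y_def finite_words finite_bit_lists)
  have x0: "x0 \<in> set xs" using odd count_notin by fastforce
  have cube: "x0 \<in> cube n" "\<And>y. y \<in> set xs \<Longrightarrow> y \<in> cube n"
    using xs x0 by (auto simp: words_def)
  have T0: "T L = 0" if L: "L \<in> \<L>" "L \<notin> (\<Union>y\<in>Y. coll y)" for L
  proof -
    have "count_list (map (lin L) xs) (lin L x0) = count_list xs x0"
      by (rule count_list_map_eq) (use L in \<open>auto simp: coll_def Y_def\<close>)
    moreover have "lin L x0 \<in> V"
      using L by (auto simp: V_def \<L>_def words_def)
    ultimately show ?thesis
      using sum_bit_sign_truth_tables_eq_0[of V "lin L x0" "map (lin L) xs"] fin odd
      by (simp add: T_def block_fun_def o_def)
  qed
  have T1: "\<bar>T L\<bar> \<le> card (Pow V)" for L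
  proof -
    have "\<bar>T L\<bar> \<le> (\<Sum>G\<in>Pow V. 1)"
      unfolding T_def
      by (rule order_trans[OF sum_abs sum_mono]) (rule abs_prod_list_le_1, simp)
    then show ?thesis by simp
  qed
  have coll: "real (2 ^ s) * card (coll y) = card \<L>" if "y \<in> Y" for y
    using card_lin_collision[of y n x0 s] that cube
    unfolding coll_def \<L>_def Y_def of_nat_mult[symmetric] by force
  have "(\<Sum>w\<in>blocks n s. prod_list (map (\<lambda>x. bit_sign (block_fun w x)) xs)) = (\<Sum>L\<in>\<L>. T L)"
    unfolding blocks_def T_def \<L>_def[symmetric] V_def[symmetric]
    by (simp add: sum.cartesian_product case_prod_unfold)
  also have "\<dots> = (\<Sum>L\<in>(\<Union>y\<in>Y. coll y). T L)"
    by (rule sum.mono_neutral_right) (use fin T0 in \<open>auto simp: coll_def\<close>)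
  also have "\<bar>\<dots>\<bar> \<le> (\<Sum>L\<in>(\<Union>y\<in>Y. coll y). real (card (Pow V)))"
    by (rule order_trans[OF sum_abs sum_mono]) (rule T1)
  also have "\<dots> = card (\<Union>y\<in>Y. coll y) * real (card (Pow V))" by simp
  also have "\<dots> \<le> (\<Sum>y\<in>Y. real (card (coll y))) * real (card (Pow V))"
    using card_UN_le[OF fin(3), of coll]
    by (intro mult_right_mono) (simp_all del: of_nat_sum add: of_nat_sum[symmetric])
  finally have "2 ^ s * \<bar>\<Sum>w\<in>blocks n s. prod_list (map (\<lambda>x. bit_sign (block_fun w x)) xs)\<bar>
      \<le> 2 ^ s * ((\<Sum>y\<in>Y. real (card (coll y))) * real (card (Pow V)))"
    by (rule mult_left_mono) simp
  also have "\<dots> = (\<Sum>y\<in>Y. real (2 ^ s) * card (coll y)) * real (card (Pow V))"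
    by (simp add: sum_distrib_left mult.assoc)
  also have "\<dots> = card Y * (real (card \<L>) * real (card (Pow V)))"
    using sum.cong[OF refl coll, of Y "\<lambda>y. y"] by simp
  also have "\<dots> \<le> real m * (real (card \<L>) * real (card (Pow V)))"
  proof (rule mult_right_mono)
    have "card Y \<le> length xs"
      unfolding Y_def by (meson card_Diff1_le card_length le_trans)
    then show "real (card Y) \<le> real m" using xs by (simp add: words_def)
  qed auto
  also have "\<dots> = real m * real (card (blocks n s))"
    by (simp add: blocks_def \<L>_def V_def card_cartesian_product)
  finally show ?thesis .
qed

text \<open>The weight \<open>h\<close> lets one estimate serve both the random XOR and its sum with
  a fixed block. The two summands come from the even and the other tuples.\<close>

lemma xor_blocks_moment:
  fixes h :: "(nat \<Rightarrow> bit) \<Rightarrow> real"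
  assumes W: "finite W" "W \<subseteq> cube n" and h: "\<And>x. \<bar>h x\<bar> \<le> 1"
  shows "(\<Sum>ws\<in>words (blocks n s) b. (\<Sum>x\<in>W. h x * bit_sign (xor_blocks ws x)) ^ (2 * t))
    \<le> real (card (blocks n s)) ^ b
        * ((2 * real t * card W) ^ t + real (card W) ^ (2 * t) * (2 * real t / 2 ^ s) ^ b)"
proof -
  define \<Omega> where "\<Omega> = words (blocks n s) b"
  define E where "E xs = (\<Sum>w\<in>blocks n s. prod_list (map (\<lambda>x. bit_sign (block_fun w x)) xs))" for xs
  define N where "N = real (card (blocks n s))"
  define Q where "Q = 2 * real t / 2 ^ s"
  have fin: "finite (words W (2 * t))" using W by (simp add: finite_words)
  have "(\<Sum>ws\<in>\<Omega>. (\<Sum>x\<in>W. h x * bit_sign (xor_blocks ws x)) ^ (2 * t))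
      = (\<Sum>ws\<in>\<Omega>. \<Sum>xs\<in>words W (2 * t). prod_list (map h xs)
           * prod_list (map (\<lambda>w. prod_list (map (\<lambda>x. bit_sign (block_fun w x)) xs)) ws))"
  proof (rule sum.cong[OF refl])
    fix ws
    have pm: "prod_list (map (\<lambda>x. h x * g x) xs) = prod_list (map h xs) * prod_list (map g xs)" for g xs
      by (induction xs) (auto simp: algebra_simps)
    have swap: "prod_list (map (\<lambda>x. bit_sign (xor_blocks ws x)) xs)
        = prod_list (map (\<lambda>w. prod_list (map (\<lambda>x. bit_sign (block_fun w x)) xs)) ws)" for xs
      unfolding bit_sign_xor_blocks by (rule prod_list_swap)
    show "(\<Sum>x\<in>W. h x * bit_sign (xor_blocks ws x)) ^ (2 * t)
      = (\<Sum>xs\<in>words W (2 * t). prod_list (map h xs)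
           * prod_list (map (\<lambda>w. prod_list (map (\<lambda>x. bit_sign (block_fun w x)) xs)) ws))"
      by (simp only: power_sum_words pm swap)
  qed
  \<comment> \<open>Summing over independent blocks turns the contribution of a tuple into the
    \<open>b\<close>-th power of its one-block sum.\<close>
  also have "\<dots> = (\<Sum>xs\<in>words W (2 * t). prod_list (map h xs) * E xs ^ b)"
    unfolding \<Omega>_def by (subst sum.swap) (simp add: E_def power_sum_words sum_distrib_left)
  \<comment> \<open>Even tuples get the trivial bound \<open>N ^ b\<close>; the bound for the other
    tuples is added for every tuple to keep the summand uniform.\<close>
  also have "\<dots> \<le> (\<Sum>xs\<in>words W (2 * t). (if xs \<in> even_words W (2 * t) then N ^ b else 0) + N ^ b * Q ^ b)"
  proof (rule sum_mono)
    fix xs assume xs: "xs \<in> words W (2 * t)"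
    have "prod_list (map h xs) * E xs ^ b \<le> \<bar>prod_list (map h xs)\<bar> * \<bar>E xs\<bar> ^ b"
      by (metis abs_ge_self abs_mult power_abs)
    also have "\<dots> \<le> 1 * \<bar>E xs\<bar> ^ b"
      by (rule mult_right_mono) (auto intro: abs_prod_list_le_1 h)
    finally have le: "prod_list (map h xs) * E xs ^ b \<le> \<bar>E xs\<bar> ^ b" by simp
    show "prod_list (map h xs) * E xs ^ b
      \<le> (if xs \<in> even_words W (2 * t) then N ^ b else 0) + N ^ b * Q ^ b"
    proof (cases "xs \<in> even_words W (2 * t)")
      case True
      have "\<bar>E xs\<bar> \<le> (\<Sum>w\<in>blocks n s. 1)"
        unfolding E_def
        by (rule order_trans[OF sum_abs sum_mono]) (rule abs_prod_list_le_1, simp)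
      then have "\<bar>E xs\<bar> ^ b \<le> N ^ b"
        by (intro power_mono) (auto simp: N_def)
      then show ?thesis using le True by (simp add: N_def Q_def add_increasing2)
    next
      case False
      then obtain x0 where "odd (count_list xs x0)"
        using xs by (auto simp: even_words_def)
      moreover have "xs \<in> words (cube n) (2 * t)"
        using xs W by (auto simp: words_def)
      ultimately have "2 ^ s * \<bar>E xs\<bar> \<le> real (2 * t) * N"
        unfolding E_def N_def by (intro block_bias)
      then have "\<bar>E xs\<bar> \<le> N * Q"
        by (simp add: Q_def field_simps)
      then have "\<bar>E xs\<bar> ^ b \<le> N ^ b * Q ^ b"
        unfolding power_mult_distrib[symmetric] by (intro power_mono) auto
      then show ?thesis using le False by simp
    qed
  qed
  also have "\<dots> = real (card (even_words W (2 * t))) * N ^ b + real (card (words W (2 * t))) * (N ^ b * Q ^ b)"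
  proof -
    have "words W (2 * t) \<inter> even_words W (2 * t) = even_words W (2 * t)"
      by (auto simp: even_words_def)
    then show ?thesis
      using fin by (simp add: sum.distrib sum.If_cases)
  qed
  also have "\<dots> \<le> (2 * real t * card W) ^ t * N ^ b + real (card W) ^ (2 * t) * (N ^ b * Q ^ b)"
  proof (intro add_mono mult_right_mono)
    have "real (card (even_words W (2 * t))) \<le> real ((2 * t * card W) ^ t)"
      using card_even_words[OF W(1), of t] by (rule of_nat_mono)
    then show "real (card (even_words W (2 * t))) \<le> (2 * real t * card W) ^ t"
      by simp
    show "real (card (words W (2 * t))) \<le> real (card W) ^ (2 * t)"
      using W by (simp add: card_words)
  qed (auto simp: N_def Q_def)
  finally show ?thesis
    by (simp add: \<Omega>_def N_def Q_def algebra_simps)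
qed

text \<open>Markov's inequality for the \<open>2 * t\<close>-th power. Taking \<open>t\<close>
  blocks makes both summands of the moment bound equal to \<open>X ^ t\<close> when \<open>W\<close>
  has \<open>2 ^ k\<close> points.\<close>

lemma card_biased_xor_blocks:
  fixes h :: "(nat \<Rightarrow> bit) \<Rightarrow> real"
  assumes W: "finite W" "W \<subseteq> cube n" "card W \<le> 2 ^ k" and h: "\<And>x. \<bar>h x\<bar> \<le> 1"
    and \<epsilon>: "\<epsilon> > 0" "32 * real t \<le> 2 ^ k * \<epsilon>\<^sup>2"
  shows "16 ^ t * card {ws \<in> words (blocks n k) t.
      \<bar>\<Sum>x\<in>W. h x * bit_sign (xor_blocks ws x)\<bar> \<ge> \<epsilon> * 2 ^ k} \<le> 2 * card (words (blocks n k) t)"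
proof -
  define \<Omega> where "\<Omega> = words (blocks n k) t"
  define F where "F ws = (\<Sum>x\<in>W. h x * bit_sign (xor_blocks ws x))" for ws
  define Bad where "Bad = {ws \<in> \<Omega>. \<bar>F ws\<bar> \<ge> \<epsilon> * 2 ^ k}"
  define X where "X = 2 * real t * 2 ^ k"
  have fin: "finite \<Omega>" by (simp add: \<Omega>_def finite_words finite_blocks)
  have card\<Omega>: "real (card \<Omega>) = real (card (blocks n k)) ^ t"
    by (simp add: \<Omega>_def card_words finite_blocks)
  have cW: "real (card W) \<le> 2 ^ k"
    using W(3) by (metis of_nat_le_iff of_nat_numeral of_nat_power)
  have "real (card Bad) * (\<epsilon> * 2 ^ k) ^ (2 * t) = (\<Sum>ws\<in>Bad. (\<epsilon> * 2 ^ k) ^ (2 * t))"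
    by simp
  also have "\<dots> \<le> (\<Sum>ws\<in>Bad. F ws ^ (2 * t))"
  proof (rule sum_mono)
    fix ws assume "ws \<in> Bad"
    then have "(\<epsilon> * 2 ^ k) ^ (2 * t) \<le> \<bar>F ws\<bar> ^ (2 * t)"
      using \<epsilon> by (intro power_mono) (auto simp: Bad_def)
    then show "(\<epsilon> * 2 ^ k) ^ (2 * t) \<le> F ws ^ (2 * t)" by (simp add: power_even_abs)
  qed
  also have "\<dots> \<le> (\<Sum>ws\<in>\<Omega>. F ws ^ (2 * t))"
    by (rule sum_mono2) (use fin in \<open>auto simp: Bad_def\<close>)
  also have "\<dots> \<le> real (card \<Omega>)
      * ((2 * real t * card W) ^ t + real (card W) ^ (2 * t) * (2 * real t / 2 ^ k) ^ t)"
    unfolding \<Omega>_def F_def using xor_blocks_moment[OF W(1,2) h, where s = k and b = t and t = t]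
    by (simp add: card\<Omega>[unfolded \<Omega>_def])
  also have "\<dots> \<le> real (card \<Omega>) * (X ^ t + (2 ^ k) ^ (2 * t) * (2 * real t / 2 ^ k) ^ t)"
    unfolding X_def using cW by (intro mult_left_mono add_mono mult_right_mono power_mono) auto
  also have "(2 ^ k) ^ (2 * t) * (2 * real t / 2 ^ k) ^ t = X ^ t"
    unfolding X_def power_mult power_mult_distrib[symmetric] by (simp add: power2_eq_square mult_ac)
  finally have "real (card Bad) * ((\<epsilon> * 2 ^ k)\<^sup>2) ^ t \<le> 2 * real (card \<Omega>) * X ^ t"
    by (simp add: power_mult)
  moreover have "16 ^ t * X ^ t \<le> ((\<epsilon> * 2 ^ k)\<^sup>2) ^ t"
  proof -
    \<comment> \<open>This is the hypothesis on \<open>\<epsilon>\<close> multiplied by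
      \<open>2 ^ k\<close>.\<close>
    have "16 * X \<le> (\<epsilon> * 2 ^ k)\<^sup>2"
      using mult_right_mono[OF \<epsilon>(2), of "2 ^ k"] by (simp add: X_def power2_eq_square algebra_simps)
    then show ?thesis
      unfolding power_mult_distrib[symmetric] by (intro power_mono) (auto simp: X_def)
  qed
  ultimately have "real (card Bad) * (16 ^ t * X ^ t) \<le> 2 * real (card \<Omega>) * X ^ t"
    by (meson mult_left_mono of_nat_0_le_iff order_trans)
  \<comment> \<open>For \<open>t = 0\<close> the base \<open>X\<close> is 0, but the power is
    1.\<close>
  moreover have "X ^ t > 0"
    by (cases "t = 0") (auto simp: X_def)
  ultimately have "real (card Bad) * 16 ^ t \<le> 2 * real (card \<Omega>)"
    by (simp add: mult.assoc[symmetric])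
  then have "real (16 ^ t * card Bad) \<le> real (2 * card \<Omega>)"
    by (simp add: mult.commute)
  then show ?thesis
    unfolding of_nat_le_iff Bad_def \<Omega>_def F_def .
qed

section \<open>Affine subspaces\<close>

lemma cube_eq_image: "cube n = (\<lambda>S i. of_bool (i \<in> S)) ` Pow {..<n}"
proof
  show "cube n \<subseteq> (\<lambda>S i. of_bool (i \<in> S)) ` Pow {..<n}"
  proof
    fix x assume x: "x \<in> cube n"
    have "x = (\<lambda>i. of_bool (i \<in> {i. x i = 1}))" by (auto simp: fun_eq_iff)
    moreover have "{i. x i = 1} \<in> Pow {..<n}"
      using x by (auto simp: cube_def not_le[symmetric])
    ultimately show "x \<in> (\<lambda>S i. of_bool (i \<in> S)) ` Pow {..<n}" by blast
  qed
qed (auto simp: cube_def)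

lemma finite_cube: "finite (cube n)"
  by (simp add: cube_eq_image)

lemma card_cube: "card (cube n) = 2 ^ n"
proof -
  have "inj_on (\<lambda>S i. of_bool (i \<in> S) :: bit) (Pow {..<n})"
    by (rule inj_onI) (auto simp: fun_eq_iff of_bool_eq_iff)
  then show ?thesis by (simp add: cube_eq_image card_image card_Pow)
qed

lemma cube_add: "x \<in> cube n \<Longrightarrow> y \<in> cube n \<Longrightarrow> x + y \<in> cube n"
  by (auto simp: cube_def)

text \<open>Over F_2 every coefficient is 0 or 1, so linear combinations are subset sums; this
  bounds the size of a \<open>k\<close>-dimensional subspace by \<open>2 ^ k\<close>.\<close>

lemma span_subset_sums:
  assumes "finite B"
  shows "F2.span B \<subseteq> (\<Sum>) ` Pow B"
proof
  fix v assume "v \<in> F2.span B"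
  then obtain u where u: "v = (\<Sum>a\<in>B. bscale (u a) a)"
    using assms by (auto simp: F2.span_finite)
  have "bscale (u a) a = (if u a = 1 then a else 0)" for a
    by (cases "u a") (auto simp: bscale_def)
  then have "v = (\<Sum>a\<in>B. if u a = 1 then a else 0)" by (simp add: u)
  also have "\<dots> = \<Sum>{a \<in> B. u a = 1}"
    using assms by (simp add: sum.inter_filter)
  finally show "v \<in> (\<Sum>) ` Pow B" by blast
qed

lemma affine_subspace_cases:
  assumes "affine_subspace n k W"
  obtains u0 U B where "u0 \<in> cube n" "W = (\<lambda>u. u0 + u) ` U" "B \<subseteq> cube n" "finite B" "card B = k"
    "F2.independent B" "U = F2.span B" "U \<subseteq> cube n"
proof -
  obtain u0 U where W: "u0 \<in> cube n" "U \<subseteq> cube n" "F2.subspace U" "F2.dim U = k" "W = (\<lambda>u. u0 + u) ` U"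
    using assms by (auto simp: affine_subspace_def)
  obtain B where B: "B \<subseteq> U" "F2.independent B" "U \<subseteq> F2.span B" "card B = F2.dim U"
    by (rule F2.basis_exists)
  have "finite B" using B W finite_cube by (meson finite_subset)
  moreover have "U = F2.span B"
    using B W by (simp add: F2.span_minimal subset_antisym)
  ultimately show ?thesis using that W B by (metis order_trans)
qed

lemma affine_subspace_subset_cube: "affine_subspace n k W \<Longrightarrow> W \<subseteq> cube n"
  by (auto simp: affine_subspace_def intro: cube_add)

lemma card_affine_subspace_le:
  assumes "affine_subspace n k W"
  shows "card W \<le> 2 ^ k"
proof -
  obtain u0 U B where B: "W = (\<lambda>u. u0 + u) ` U" "finite B" "card B = k" "U = F2.span B"
    using affine_subspace_cases[OF assms] by metis
  have "card U \<le> card ((\<Sum>) ` Pow B)"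
    using span_subset_sums[OF B(2)] B by (intro card_mono) auto
  also have "\<dots> \<le> 2 ^ k"
    using card_image_le[of "Pow B" Sum] B by (simp add: card_Pow)
  finally have "card U \<le> 2 ^ k" .
  moreover have "finite U"
    using span_subset_sums[OF B(2)] B by (auto intro: finite_subset)
  ultimately show ?thesis using B(1) card_image_le le_trans by blast
qed

text \<open>Makes the extractor property vacuous for \<open>k > n\<close>, a case that does occur
  when \<open>\<epsilon>\<close> is small.\<close>

lemma affine_subspace_dim_le:
  assumes "affine_subspace n k W"
  shows "k \<le> n"
proof -
  obtain B where B: "B \<subseteq> cube n" "card B = k" "F2.independent B"
    using affine_subspace_cases[OF assms] by metis
  define e where "e i = (\<lambda>j. of_bool (j = i) :: bit)" for i :: nat
  have "cube n \<subseteq> F2.span (e ` {..<n})"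
  proof
    fix x assume x: "x \<in> cube n"
    have "x j = (\<Sum>i<n. bscale (x i) (e i)) j" for j
    proof -
      have "(\<Sum>i\<in>A. bscale (x i) (e i)) j = (\<Sum>i\<in>A. if i = j then x i else 0)" for A
        by (induction A rule: infinite_finite_induct) (auto simp: bscale_def e_def)
      then show ?thesis using x by (auto simp: cube_def not_less[symmetric])
    qed
    then have "x = (\<Sum>i<n. bscale (x i) (e i))" by blast
    also have "\<dots> \<in> F2.span (e ` {..<n})"
      by (intro F2.span_sum F2.span_scale F2.span_base) auto
    finally show "x \<in> F2.span (e ` {..<n})" .
  qed
  then have "card B \<le> card (e ` {..<n})"
    using F2.independent_span_bound[of "e ` {..<n}" B] B by blast
  also have "\<dots> \<le> n" using card_image_le[of "{..<n}" e] by simp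
  finally show ?thesis using B by simp
qed

text \<open>A subspace is determined by a shift and a list of \<open>k\<close> spanning vectors,
  that is, by \<open>k + 1\<close> points of the cube.\<close>

lemma finite_affine_subspaces: "finite {W. affine_subspace n k W}"
  and card_affine_subspaces_le: "card {W. affine_subspace n k W} \<le> 2 ^ (n * (k + 1))"
proof -
  let ?P = "cube n \<times> words (cube n) k"
  let ?f = "\<lambda>(u0, bs). (\<lambda>u. u0 + u) ` F2.span (set bs)"
  have fin: "finite ?P" by (simp add: finite_cube finite_words)
  have sub: "{W. affine_subspace n k W} \<subseteq> ?f ` ?P"
  proof
    fix W assume "W \<in> {W. affine_subspace n k W}"
    then obtain u0 U B where B: "u0 \<in> cube n" "W = (\<lambda>u. u0 + u) ` U" "B \<subseteq> cube n" "finite B" "card B = k"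
        "U = F2.span B"
      using affine_subspace_cases by (metis mem_Collect_eq)
    obtain bs where bs: "set bs = B" "length bs = card B"
      using B(4) by (metis distinct_card finite_distinct_list)
    have "(u0, bs) \<in> ?P" using B bs by (auto simp: words_def)
    moreover have "W = ?f (u0, bs)" using B bs by simp
    ultimately show "W \<in> ?f ` ?P" by (rule rev_image_eqI)
  qed
  show "finite {W. affine_subspace n k W}"
    using sub fin by (auto intro: finite_subset)
  have "card {W. affine_subspace n k W} \<le> card ?P"
    using sub fin by (meson card_image_le card_mono finite_imageI le_trans)
  also have "\<dots> = 2 ^ (n * (k + 1))"
    by (simp add: card_cartesian_product card_words finite_cube card_cube power_add power_mult)
  finally show "card {W. affine_subspace n k W} \<le> 2 ^ (n * (k + 1))" .
qed

section \<open>Existence of the extractor\<close>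

text \<open>A union bound over pairs of a subspace and a weight: the weight 1 concerns
  \<open>xor_blocks ws\<close>, the sign of \<open>w0\<close> concerns
  \<open>xor_blocks (w0 # ws)\<close>. A single \<open>ws\<close> therefore serves both.\<close>

lemma exists_extractor_xor_blocks:
  assumes n: "n > 0" and k: "k \<ge> 2" and \<epsilon>: "\<epsilon> > 0" "32 * real (n * k) \<le> 2 ^ k * \<epsilon>\<^sup>2"
  obtains ws where "ws \<in> words (blocks n k) (n * k)"
    "affine_extractor n k \<epsilon> (xor_blocks ws)" "affine_extractor n k \<epsilon> (xor_blocks (w0 # ws))"
proof -
  define t where "t = n * k"
  define \<Omega> where "\<Omega> = words (blocks n k) t"
  define \<W> where "\<W> = {W. affine_subspace n k W}"
  define H where "H = {\<lambda>x. 1, \<lambda>x. bit_sign (block_fun w0 x)}"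
  define Bad where "Bad = (\<lambda>(W, h). {ws \<in> \<Omega>. \<bar>\<Sum>x\<in>W. h x * bit_sign (xor_blocks ws x)\<bar> \<ge> \<epsilon> * 2 ^ k})"
  have fin: "finite \<Omega>" "finite \<W>" "finite H"
    by (simp_all add: \<Omega>_def \<W>_def H_def finite_words finite_blocks finite_affine_subspaces)
  have cH: "card H \<le> 2" unfolding H_def by (simp add: card_insert_if)
  have "16 ^ t * card (\<Union>p\<in>\<W> \<times> H. Bad p) \<le> 16 ^ t * (\<Sum>p\<in>\<W> \<times> H. card (Bad p))"
    using fin by (intro mult_le_mono2 card_UN_le) auto
  also have "\<dots> = (\<Sum>p\<in>\<W> \<times> H. 16 ^ t * card (Bad p))"
    by (simp add: sum_distrib_left)
  also have "\<dots> \<le> (\<Sum>p\<in>\<W> \<times> H. 2 * card \<Omega>)"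
  proof (rule sum_mono)
    fix p assume "p \<in> \<W> \<times> H"
    then obtain W h where p: "p = (W, h)" "affine_subspace n k W" "h \<in> H"
      by (auto simp: \<W>_def)
    have "W \<subseteq> cube n" using p affine_subspace_subset_cube by blast
    moreover have "finite W" using calculation finite_cube finite_subset by blast
    ultimately show "16 ^ t * card (Bad p) \<le> 2 * card \<Omega>"
      unfolding Bad_def p(1) prod.case \<Omega>_def
      by (intro card_biased_xor_blocks) (use p \<epsilon> card_affine_subspace_le in \<open>auto simp: t_def H_def\<close>)
  qed
  also have "\<dots> \<le> 2 ^ (n * (k + 1)) * 2 * (2 * card \<Omega>)"
    using card_affine_subspaces_le[of n k] cH
    by (simp add: card_cartesian_product \<W>_def mult_le_mono)
  also have "\<dots> = 2 ^ (n * (k + 1) + 2) * card \<Omega>"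
    by (simp add: power_add)
  also have "\<dots> < 16 ^ t * card \<Omega>"
  proof (rule mult_strict_right_mono)
    \<comment> \<open>In the exponent, 2 is added for the two weights and for the factor 2 of the
      tail bound; against it stands \<open>16 ^ t = 2 ^ (4 * t)\<close> with
      \<open>t = n * k\<close>.\<close>
    have "2 * n \<le> k * n" using k by simp
    moreover have "n * (k + 1) + 2 = k * n + n + 2" "4 * t = k * n + 3 * (k * n)"
      by (simp_all add: t_def)
    ultimately have "n * (k + 1) + 2 < 4 * t" using n by linarith
    then have "(2::nat) ^ (n * (k + 1) + 2) < 2 ^ (4 * t)" by (intro power_strict_increasing) auto
    then show "(2::nat) ^ (n * (k + 1) + 2) < 16 ^ t" by (simp add: power_mult)
    show "0 < card \<Omega>"
      using blocks_nonempty[of n k] by (simp add: \<Omega>_def card_words finite_blocks card_gt_0_iff)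
  qed
  finally have "card (\<Union>p\<in>\<W> \<times> H. Bad p) < card \<Omega>" by simp
  moreover have "(\<Union>p\<in>\<W> \<times> H. Bad p) \<subseteq> \<Omega>" by (auto simp: Bad_def)
  ultimately obtain ws where ws: "ws \<in> \<Omega>" "ws \<notin> (\<Union>p\<in>\<W> \<times> H. Bad p)"
    by (metis less_irrefl subsetI subset_antisym)
  then have good: "\<bar>\<Sum>x\<in>W. h x * bit_sign (xor_blocks ws x)\<bar> < \<epsilon> * 2 ^ k"
    if "affine_subspace n k W" "h \<in> H" for W h
    using that by (force simp: Bad_def \<W>_def)
  have "affine_extractor n k \<epsilon> (xor_blocks ws)"
    using good[of _ "\<lambda>x. 1"] by (auto simp: affine_extractor_def H_def divide_less_eq abs_divide)
  moreover have "affine_extractor n k \<epsilon> (xor_blocks (w0 # ws))"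
    using good[of _ "\<lambda>x. bit_sign (block_fun w0 x)"]
    by (auto simp: affine_extractor_def H_def divide_less_eq abs_divide xor_blocks_def bit_sign_add)
  ultimately show ?thesis using that ws by (simp add: \<Omega>_def t_def)
qed

section \<open>Degree\<close>

lemma anf_eqI: "represents n c f \<Longrightarrow> anf n f = c"
  unfolding anf_def by (rule the_equality) (auto intro: represents_unique)

lemma represents_add:
  assumes "represents n c f" "represents n d g"
  shows "represents n (\<lambda>S. c S + d S) (\<lambda>x. f x + g x)"
  using assms
  by (auto simp: represents_def multilinear_eval_def sum.distrib algebra_simps)

lemma represents_monomial:
  assumes "S \<subseteq> {..<n}"
  shows "represents n (\<lambda>T. of_bool (T = S)) (\<lambda>x. \<Prod>i\<in>S. x i)"
proof -
  have "(\<Sum>T\<in>Pow {..<n}. of_bool (T = S) * (\<Prod>i\<in>T. x i))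
      = (\<Sum>T\<in>Pow {..<n}. if T = S then (\<Prod>i\<in>S. x i) else 0)" for x :: "nat \<Rightarrow> bit"
    by (rule sum.cong) auto
  then show ?thesis
    using assms by (auto simp: represents_def multilinear_eval_def)
qed

text \<open>Degree is bounded through any representing coefficients, so that closure under sums and
  products can be proved without the definite description in \<open>anf\<close>.\<close>

definition deg_le :: "nat \<Rightarrow> nat \<Rightarrow> ((nat \<Rightarrow> bit) \<Rightarrow> bit) \<Rightarrow> bool" where
  "deg_le n d f \<longleftrightarrow> (\<exists>c. represents n c f \<and> (\<forall>S. c S \<noteq> 0 \<longrightarrow> card S \<le> d))"

lemma f2_degree_le:
  assumes "deg_le n d f"
  shows "f2_degree n f \<le> d"
proof -
  obtain c where "represents n c f" "\<And>S. c S \<noteq> 0 \<Longrightarrow> card S \<le> d"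
    using assms by (auto simp: deg_le_def)
  then show ?thesis
    by (auto simp: f2_degree_def anf_eqI)
qed

lemma f2_degree_ge:
  assumes "S \<subseteq> {..<n}" "anf n f S \<noteq> 0"
  shows "card S \<le> f2_degree n f"
  unfolding f2_degree_def by (rule Max_ge) (use assms in auto)

lemma deg_le_0: "deg_le n d (\<lambda>x. 0)"
  unfolding deg_le_def
  by (rule exI[of _ "\<lambda>S. 0"]) (simp add: represents_def multilinear_eval_def)

lemma deg_le_add:
  assumes "deg_le n d f" "deg_le n d g"
  shows "deg_le n d (\<lambda>x. f x + g x)"
proof -
  obtain a b where "represents n a f" "represents n b g"
    and d: "\<And>S. a S \<noteq> 0 \<Longrightarrow> card S \<le> d" "\<And>S. b S \<noteq> 0 \<Longrightarrow> card S \<le> d"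
    using assms by (auto simp: deg_le_def)
  then have "represents n (\<lambda>S. a S + b S) (\<lambda>x. f x + g x)"
    by (simp add: represents_add)
  moreover have "card S \<le> d" if "a S + b S \<noteq> 0" for S
    using that d[of S] by (cases "a S = 0") auto
  ultimately show ?thesis unfolding deg_le_def by blast
qed

lemma deg_le_sum: "(\<And>i. i \<in> I \<Longrightarrow> deg_le n d (f i)) \<Longrightarrow> deg_le n d (\<lambda>x. \<Sum>i\<in>I. f i x)"
  by (induction I rule: infinite_finite_induct) (auto intro: deg_le_0 deg_le_add)

lemma deg_le_sum_list:
  "(\<And>w. w \<in> set ws \<Longrightarrow> deg_le n d (f w)) \<Longrightarrow> deg_le n d (\<lambda>x. sum_list (map (\<lambda>w. f w x) ws))"
  by (induction ws) (auto intro: deg_le_0 deg_le_add)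

lemma deg_le_monomial:
  assumes "S \<subseteq> {..<n}" "card S \<le> d"
  shows "deg_le n d (\<lambda>x. \<Prod>i\<in>S. x i)"
  unfolding deg_le_def using represents_monomial[OF assms(1)] assms(2)
  by (intro exI[of _ "\<lambda>T. of_bool (T = S)"]) auto

lemma deg_le_cong: "deg_le n d f \<Longrightarrow> (\<And>x. x \<in> cube n \<Longrightarrow> f x = g x) \<Longrightarrow> deg_le n d g"
  by (auto simp: deg_le_def represents_def)

text \<open>Since bits are idempotent, the product of the monomials of \<open>S\<close> and
  \<open>T\<close> is that of \<open>S \<union> T\<close>, whose size is at most the sum.\<close>

lemma deg_le_mult:
  assumes "deg_le n a f" "deg_le n b g"
  shows "deg_le n (a + b) (\<lambda>x. f x * g x)"
proof -
  obtain c d where c: "represents n c f" "\<And>S. c S \<noteq> 0 \<Longrightarrow> card S \<le> a"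
    and d: "represents n d g" "\<And>S. d S \<noteq> 0 \<Longrightarrow> card S \<le> b"
    using assms unfolding deg_le_def by blast
  let ?P = "Pow {..<n}"
  have mono: "(\<Prod>i\<in>S. x i) * (\<Prod>i\<in>T. x i) = (\<Prod>i\<in>S \<union> T. x i)"
    if "S \<in> ?P" "T \<in> ?P" for S T and x :: "nat \<Rightarrow> bit"
  proof -
    have fin: "finite S" "finite T" using that by (auto intro: finite_subset)
    have "(\<Prod>i\<in>S. x i) = of_bool (\<forall>i\<in>S. x i = 1)" if "finite S" for S
      using that by induction auto
    then show ?thesis using fin by auto
  qed
  have "deg_le n (a + b) (\<lambda>x. \<Sum>S\<in>?P. \<Sum>T\<in>?P. c S * d T * (\<Prod>i\<in>S \<union> T. x i))"
  proof (intro deg_le_sum)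
    fix S T assume ST: "S \<in> ?P" "T \<in> ?P"
    show "deg_le n (a + b) (\<lambda>x. c S * d T * (\<Prod>i\<in>S \<union> T. x i))"
    proof (cases "c S = 0 \<or> d T = 0")
      case True
      then show ?thesis using deg_le_0 by auto
    next
      case False
      then have "card (S \<union> T) \<le> a + b"
        using c(2)[of S] d(2)[of T] card_Un_le[of S T] by linarith
      moreover have "c S * d T = 1" using False by (cases "c S"; cases "d T") auto
      ultimately show ?thesis using deg_le_monomial[of "S \<union> T"] ST by auto
    qed
  qed
  then show ?thesis
  proof (rule deg_le_cong)
    fix x :: "nat \<Rightarrow> bit" assume "x \<in> cube n"
    then have "f x * g x = (\<Sum>S\<in>?P. \<Sum>T\<in>?P. c S * d T * ((\<Prod>i\<in>S. x i) * (\<Prod>i\<in>T. x i)))"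
      using c(1) d(1) by (simp add: represents_def multilinear_eval_def sum_product algebra_simps)
    also have "\<dots> = (\<Sum>S\<in>?P. \<Sum>T\<in>?P. c S * d T * (\<Prod>i\<in>S \<union> T. x i))"
      by (intro sum.cong refl) (simp add: mono)
    finally show "(\<Sum>S\<in>?P. \<Sum>T\<in>?P. c S * d T * (\<Prod>i\<in>S \<union> T. x i)) = f x * g x" by simp
  qed
qed

lemma deg_le_const: "deg_le n d (\<lambda>x. c)"
  using deg_le_0 deg_le_monomial[of "{}" n d] by (cases c) auto

lemma deg_le_xor_gate:
  assumes "A \<subseteq> {..<n}"
  shows "deg_le n 1 (xor_gate_eval (A, b))"
proof -
  have "deg_le n 1 (\<lambda>x. x i)" if "i \<in> A" for i
    using deg_le_monomial[of "{i}" n 1] that assms by auto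
  then show ?thesis
    unfolding xor_gate_eval_def by (auto intro!: deg_le_add deg_le_sum deg_le_const)
qed

lemma deg_le_prod_xor_gates:
  assumes "\<And>i. i < (s::nat) \<Longrightarrow> A i \<subseteq> {..<n}"
  shows "deg_le n s (\<lambda>x. \<Prod>i<s. xor_gate_eval (A i, b i) x)"
  using assms
proof (induction s)
  case 0
  then show ?case by (simp add: deg_le_const)
next
  case (Suc s)
  have "deg_le n (s + 1) (\<lambda>x. (\<Prod>i<s. xor_gate_eval (A i, b i) x) * xor_gate_eval (A s, b s) x)"
    by (intro deg_le_mult deg_le_xor_gate Suc) (auto intro: Suc)
  then show ?case by simp
qed

text \<open>The disjunctive normal form of the truth table: at most one \<open>v\<close> agrees with
  \<open>lin L x\<close>, so XOR may replace OR. Both the degree bound and the circuit rest on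
  it.\<close>

lemma block_fun_eq_sum_prod:
  assumes "w \<in> blocks n s"
  shows "block_fun w x = (\<Sum>v\<in>snd w. \<Prod>i<s. xor_gate_eval (fst w ! i, v ! i + 1) x)"
proof -
  obtain L G where w: "w = (L, G)" by (cases w)
  have L: "length L = s" and G: "G \<subseteq> {v. length v = s}"
    using assms by (auto simp: w blocks_def words_def)
  then have fin: "finite G" using finite_bit_lists[of s] by (auto intro: finite_subset)
  have "(\<Prod>i<s. xor_gate_eval (L ! i, v ! i + 1) x) = of_bool (lin L x = v)" if v: "v \<in> G" for v
  proof -
    \<comment> \<open>Adding \<open>v ! i + 1\<close> turns the parity of row \<open>i\<close> into
      the test whether it equals \<open>v ! i\<close>.\<close>
    have gate: "xor_gate_eval (L ! i, v ! i + 1) x = of_bool (lin L x ! i = v ! i)" if "i < s" for i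
    proof -
      have "lin L x ! i = (\<Sum>j\<in>L ! i. x j)" using that L by (simp add: lin_def)
      moreover have "a + (b + 1) = of_bool (a = b)" for a b :: bit by (cases a; cases b) auto
      ultimately show ?thesis by (simp add: xor_gate_eval_def)
    qed
    have "(\<Prod>i<s. xor_gate_eval (L ! i, v ! i + 1) x) = (\<Prod>i<s. of_bool (lin L x ! i = v ! i))"
      by (rule prod.cong) (simp_all add: gate)
    also have "\<dots> = of_bool (\<forall>i<s. lin L x ! i = v ! i)"
      by (induction s) (auto simp: less_Suc_eq)
    also have "\<dots> = of_bool (lin L x = v)"
      using L(1) subsetD[OF G v] by (simp add: list_eq_iff_nth_eq)
    finally show ?thesis .
  qed
  then have "(\<Sum>v\<in>G. \<Prod>i<s. xor_gate_eval (L ! i, v ! i + 1) x) = (\<Sum>v\<in>G. if lin L x = v then 1 else 0)"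
    by (intro sum.cong) auto
  then show ?thesis using fin by (simp add: w block_fun_def)
qed

lemma blocks_rows: "w \<in> blocks n s \<Longrightarrow> i < s \<Longrightarrow> fst w ! i \<subseteq> {..<n}"
  by (auto simp: blocks_def words_def subset_iff dest: nth_mem)

lemma deg_le_xor_blocks:
  assumes "set ws \<subseteq> blocks n s"
  shows "deg_le n s (xor_blocks ws)"
  unfolding xor_blocks_def
proof (rule deg_le_sum_list)
  fix w assume "w \<in> set ws"
  then have w: "w \<in> blocks n s" using assms by auto
  show "deg_le n s (block_fun w)"
    unfolding block_fun_eq_sum_prod[OF w]
    by (intro deg_le_sum deg_le_prod_xor_gates blocks_rows[OF w])
qed

text \<open>Encoding the monomial as a block keeps the corrected function an XOR of blocks, so the
  bounds on degree, circuit and formula cover it.\<close>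

definition monomial_block :: "nat \<Rightarrow> nat set list \<times> bit list set" where
  "monomial_block d = (map (\<lambda>i. {i}) [0..<d], {replicate d 1})"

lemma monomial_block_in_blocks: "d \<le> n \<Longrightarrow> monomial_block d \<in> blocks n d"
  by (auto simp: monomial_block_def blocks_def words_def)

lemma block_fun_monomial_block: "block_fun (monomial_block d) x = (\<Prod>i<d. x i)"
proof -
  have "lin (map (\<lambda>i. {i}) [0..<d]) x = replicate d 1 \<longleftrightarrow> (\<forall>i<d. x i = 1)"
    by (auto simp: lin_def list_eq_iff_nth_eq)
  then have "block_fun (monomial_block d) x = of_bool (\<forall>i<d. x i = 1)"
    by (simp add: block_fun_def monomial_block_def)
  also have "\<dots> = (\<Prod>i<d. x i)"
    by (induction d) (auto simp: less_Suc_eq)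
  finally show ?thesis .
qed

text \<open>Exactly one of the two functions contains the monomial in the first \<open>d\<close>
  variables, and neither exceeds degree \<open>d\<close>.\<close>

lemma f2_degree_xor_monomial_block:
  assumes d: "d \<le> n" and ws: "set ws \<subseteq> blocks n d"
  shows "f2_degree n (xor_blocks ws) = d \<or> f2_degree n (xor_blocks (monomial_block d # ws)) = d"
proof -
  obtain c where c: "represents n c (xor_blocks ws)"
    using represents_exists by blast
  have "represents n (\<lambda>T. of_bool (T = {..<d}) + c T) (xor_blocks (monomial_block d # ws))"
    using represents_add[OF represents_monomial[of "{..<d}" n] c] d
    by (simp add: xor_blocks_def[abs_def] block_fun_monomial_block)
  then have "anf n (xor_blocks ws) {..<d} \<noteq> 0 \<or> anf n (xor_blocks (monomial_block d # ws)) {..<d} \<noteq> 0"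
    using anf_eqI[OF c] by (cases "c {..<d}") (auto simp: anf_eqI)
  then have "d \<le> f2_degree n (xor_blocks ws) \<or> d \<le> f2_degree n (xor_blocks (monomial_block d # ws))"
    using f2_degree_ge[of "{..<d}" n] d by fastforce
  moreover have "f2_degree n (xor_blocks ws) \<le> d"
    using ws by (intro f2_degree_le deg_le_xor_blocks)
  moreover have "f2_degree n (xor_blocks (monomial_block d # ws)) \<le> d"
    using ws monomial_block_in_blocks[OF d] by (intro f2_degree_le deg_le_xor_blocks) auto
  ultimately show ?thesis by linarith
qed

section \<open>Circuits and formulas\<close>

text \<open>\<open>m\<close> leaves out the top gate, because XORing two circuits merges their top
  gates; this makes the measure additive.\<close>

definition xax_le :: "nat \<Rightarrow> nat \<Rightarrow> ((nat \<Rightarrow> bit) \<Rightarrow> bit) \<Rightarrow> bool" where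
  "xax_le n m f \<longleftrightarrow> (\<exists>K. xax_computes n K f \<and> xax_size K \<le> m + 1)"

lemma xax_le_0: "xax_le n m (\<lambda>x. 0)"
  unfolding xax_le_def by (rule exI[of _ "XAX [] [] {}"]) (simp add: xax_computes_def)

lemma xax_le_add:
  assumes "xax_le n l f" "xax_le n m g"
  shows "xax_le n (l + m) (\<lambda>x. f x + g x)"
proof -
  obtain bs ms t where 1: "xax_computes n (XAX bs ms t) f" "length bs + length ms \<le> l"
    using assms(1) unfolding xax_le_def by (metis xax_size.simps xax_circuit.exhaust add_le_cancel_right)
  obtain bs' ms' t' where 2: "xax_computes n (XAX bs' ms' t') g" "length bs' + length ms' \<le> m"
    using assms(2) unfolding xax_le_def by (metis xax_size.simps xax_circuit.exhaust add_le_cancel_right)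
  \<comment> \<open>AND gates of the second circuit refer to bottom gates that now come after those
    of the first.\<close>
  define sh where "sh M = (\<lambda>l. length bs + l) ` M" for M
  define K where "K = XAX (bs @ bs') (ms @ map sh ms') (t \<union> (\<lambda>j. length ms + j) ` t')"
  have wf: "xax_wf n (XAX bs ms t)" "xax_wf n (XAX bs' ms' t')"
    using 1 2 by (auto simp: xax_computes_def)
  have "xax_wf n K"
    using wf by (force simp: K_def sh_def)
  moreover have "xax_eval K x = xax_eval (XAX bs ms t) x + xax_eval (XAX bs' ms' t') x" for x
  proof -
    let ?e = "\<lambda>j. \<Prod>l\<in>(ms @ map sh ms') ! j. xor_gate_eval ((bs @ bs') ! l) x"
    have fin: "finite t" "finite t'" using wf by (auto intro: finite_subset)
    have "xax_eval K x = sum ?e t + sum ?e ((\<lambda>j. length ms + j) ` t')"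
      unfolding K_def xax_eval.simps by (rule sum.union_disjoint) (use fin wf in auto)
    also have "sum ?e ((\<lambda>j. length ms + j) ` t') = (\<Sum>j\<in>t'. ?e (length ms + j))"
      by (simp add: sum.reindex)
    also have "\<dots> = xax_eval (XAX bs' ms' t') x"
      unfolding xax_eval.simps
    proof (rule sum.cong[OF refl])
      fix j assume "j \<in> t'"
      then have "j < length ms'" using wf by auto
      then show "?e (length ms + j) = (\<Prod>l\<in>ms' ! j. xor_gate_eval (bs' ! l) x)"
        by (simp add: sh_def prod.reindex)
    qed
    also have "sum ?e t = xax_eval (XAX bs ms t) x"
      unfolding xax_eval.simps
    proof (rule sum.cong[OF refl])
      fix j assume "j \<in> t"
      then have j: "j < length ms" using wf by auto
      then have "ms ! j \<subseteq> {..<length bs}" using wf by auto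
      then show "?e j = (\<Prod>l\<in>ms ! j. xor_gate_eval (bs ! l) x)"
        using j by (auto simp: nth_append intro!: prod.cong)
    qed
    finally show ?thesis .
  qed
  moreover have "xax_size K \<le> l + m + 1"
    using 1 2 by (simp add: K_def)
  ultimately show ?thesis
    using 1 2 unfolding xax_le_def xax_computes_def by (intro exI[of _ K]) auto
qed

lemma xax_le_sum:
  "finite I \<Longrightarrow> (\<And>i. i \<in> I \<Longrightarrow> xax_le n m (f i)) \<Longrightarrow> xax_le n (card I * m) (\<lambda>x. \<Sum>i\<in>I. f i x)"
  by (induction I rule: finite_induct) (auto intro: xax_le_0 xax_le_add)

lemma xax_le_sum_list:
  "(\<And>w. w \<in> set ws \<Longrightarrow> xax_le n m (f w)) \<Longrightarrow> xax_le n (length ws * m) (\<lambda>x. sum_list (map (\<lambda>w. f w x) ws))"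
  by (induction ws) (auto intro: xax_le_0 xax_le_add)

lemma xax_le_mono: "xax_le n l f \<Longrightarrow> l \<le> m \<Longrightarrow> xax_le n m f"
  unfolding xax_le_def by (meson add_le_mono1 le_trans)

lemma xax_le_prod_xor_gates:
  assumes "\<And>i. i < (s::nat) \<Longrightarrow> A i \<subseteq> {..<n}"
  shows "xax_le n (s + 1) (\<lambda>x. \<Prod>i<s. xor_gate_eval (A i, b i) x)"
  unfolding xax_le_def using assms
  by (intro exI[of _ "XAX (map (\<lambda>i. (A i, b i)) [0..<s]) [{..<s}] {0}"])
    (auto simp: xax_computes_def intro!: prod.cong)

text \<open>Every minterm receives its own \<open>s\<close> bottom gates and one AND gate, and a
  block has at most \<open>2 ^ s\<close> minterms.\<close>

lemma xax_le_xor_blocks: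
  assumes ws: "set ws \<subseteq> blocks n s"
  shows "xax_le n (length ws * (2 ^ s * (s + 1))) (xor_blocks ws)"
  unfolding xor_blocks_def
proof (rule xax_le_sum_list)
  fix w assume "w \<in> set ws"
  then have w: "w \<in> blocks n s" using ws by auto
  then have G: "snd w \<subseteq> {v. length v = s}" by (auto simp: blocks_def)
  have "xax_le n (card (snd w) * (s + 1)) (block_fun w)"
    unfolding block_fun_eq_sum_prod[OF w]
    using G finite_bit_lists by (intro xax_le_sum xax_le_prod_xor_gates blocks_rows[OF w]) (rule finite_subset)
  moreover have "card (snd w) \<le> 2 ^ s"
    using card_mono[OF finite_bit_lists G] by (simp add: card_bit_lists)
  ultimately show "xax_le n (2 ^ s * (s + 1)) (block_fun w)"
    by (rule xax_le_mono[OF _ mult_le_mono1])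
qed

section \<open>De Morgan formulas for XORs of blocks\<close>

definition dm_le :: "nat \<Rightarrow> nat \<Rightarrow> ((nat \<Rightarrow> bit) \<Rightarrow> bit) \<Rightarrow> bool" where
  "dm_le n m f \<longleftrightarrow> (\<exists>F. dm_computes n F f \<and> dm_size F \<le> m)"

text \<open>Negation by De Morgan's laws leaves the size unchanged, which keeps multiplexers and
  XORs cheap.\<close>

primrec dm_neg :: "dm_formula \<Rightarrow> dm_formula" where
  "dm_neg (DLit s i) = DLit (\<not> s) i"
| "dm_neg (DAnd F G) = DOr (dm_neg F) (dm_neg G)"
| "dm_neg (DOr F G) = DAnd (dm_neg F) (dm_neg G)"

lemma dm_neg_simps [simp]:
  "dm_size (dm_neg F) = dm_size F" "dm_vars (dm_neg F) = dm_vars F" "dm_eval (dm_neg F) x \<longleftrightarrow> \<not> dm_eval F x"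
  by (induction F) auto

lemma dm_le_mono: "dm_le n l f \<Longrightarrow> l \<le> m \<Longrightarrow> dm_le n m f"
  unfolding dm_le_def by (meson le_trans)

text \<open>Formulas have no constant leaves, so a constant is written with the two literals of
  variable 0, which exists as \<open>n > 0\<close>.\<close>

lemma dm_le_const:
  assumes "n > 0"
  shows "dm_le n 2 (\<lambda>x. c)"
proof -
  define F where "F = (if c = 1 then DOr (DLit True 0) (DLit False 0) else DAnd (DLit True 0) (DLit False 0))"
  show ?thesis
    unfolding dm_le_def using assms by (intro exI[of _ F]) (auto simp: dm_computes_def F_def)
qed

lemma dm_le_mux:
  assumes "dm_le n p g" "dm_le n l f1" "dm_le n m f0"
  shows "dm_le n (2 * p + l + m) (\<lambda>x. if g x = 1 then f1 x else f0 x)"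
proof -
  obtain G F1 F0 where "dm_computes n G g" "dm_size G \<le> p" "dm_computes n F1 f1" "dm_size F1 \<le> l"
    "dm_computes n F0 f0" "dm_size F0 \<le> m"
    using assms unfolding dm_le_def by blast
  then show ?thesis
    unfolding dm_le_def
    by (intro exI[of _ "DOr (DAnd G F1) (DAnd (dm_neg G) F0)"]) (auto simp: dm_computes_def)
qed

text \<open>With fan-out 1 both operands are written twice, once negated. A balanced tree thus
  multiplies the size by 4 per level.\<close>

lemma dm_le_add:
  assumes "dm_le n l f" "dm_le n m g"
  shows "dm_le n (2 * l + 2 * m) (\<lambda>x. f x + g x)"
proof -
  obtain F G where "dm_computes n F f" "dm_size F \<le> l" "dm_computes n G g" "dm_size G \<le> m"
    using assms unfolding dm_le_def by blast
  moreover have "a + b = 1 \<longleftrightarrow> (a = 1 \<and> b \<noteq> 1 \<or> a \<noteq> 1 \<and> b = 1)" for a b :: bit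
    by (cases a; cases b) auto
  ultimately show ?thesis
    unfolding dm_le_def
    by (intro exI[of _ "DOr (DAnd F (dm_neg G)) (DAnd (dm_neg F) G)"]) (auto simp: dm_computes_def)
qed

lemma dm_le_sum_list_pow2:
  assumes "n > 0" "\<sigma> \<ge> 2" "\<And>w. w \<in> set ws \<Longrightarrow> dm_le n \<sigma> (f w)" "length ws \<le> 2 ^ j"
  shows "dm_le n (4 ^ j * \<sigma>) (\<lambda>x. sum_list (map (\<lambda>w. f w x) ws))"
  using assms
proof (induction j arbitrary: ws)
  case 0
  show ?case
  proof (cases ws)
    case Nil
    \<comment> \<open>The empty list is the constant 0, whose two leaves are covered by
      \<open>\<sigma> \<ge> 2\<close>.\<close>
    then show ?thesis using dm_le_mono[OF dm_le_const[of n 0]] 0 by simp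
  next
    case (Cons w ws')
    then show ?thesis using 0 by simp
  qed
next
  case (Suc j)
  let ?u = "take (2 ^ j) ws" and ?v = "drop (2 ^ j) ws"
  have "dm_le n (4 ^ j * \<sigma>) (\<lambda>x. sum_list (map (\<lambda>w. f w x) ?u))"
    by (rule Suc.IH) (use Suc.prems in \<open>auto dest: in_set_takeD\<close>)
  moreover have "dm_le n (4 ^ j * \<sigma>) (\<lambda>x. sum_list (map (\<lambda>w. f w x) ?v))"
    by (rule Suc.IH) (use Suc.prems in \<open>auto dest: in_set_dropD\<close>)
  ultimately have "dm_le n (2 * (4 ^ j * \<sigma>) + 2 * (4 ^ j * \<sigma>))
      (\<lambda>x. sum_list (map (\<lambda>w. f w x) ?u) + sum_list (map (\<lambda>w. f w x) ?v))"
    by (rule dm_le_add)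
  moreover have "sum_list (map (\<lambda>w. f w x) ?u) + sum_list (map (\<lambda>w. f w x) ?v)
      = sum_list (map (\<lambda>w. f w x) ws)" for x
    by (metis append_take_drop_id map_append sum_list_append)
  ultimately show ?case by (simp add: mult_ac)
qed

text \<open>Rounding \<open>N\<close> up to a power of two at most doubles it, hence the factor 4
  after squaring.\<close>

lemma dm_le_sum_list:
  assumes "n > 0" "\<sigma> \<ge> 2" "\<And>w. w \<in> set ws \<Longrightarrow> dm_le n \<sigma> (f w)" "length ws \<le> N" "N > 0"
  shows "dm_le n (4 * N\<^sup>2 * \<sigma>) (\<lambda>x. sum_list (map (\<lambda>w. f w x) ws))"
proof -
  have "\<exists>j. N \<le> 2 ^ j \<and> 2 ^ j \<le> 2 * N" using \<open>N > 0\<close>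
  proof (induction N rule: nat_induct_non_zero)
    case 1
    show ?case by (rule exI[of _ 0]) simp
  next
    case (Suc N)
    then obtain j where "N \<le> 2 ^ j" "2 ^ j \<le> 2 * N" by blast
    then show ?case
      by (cases "N = 2 ^ j") (auto intro: exI[of _ j] exI[of _ "Suc j"])
  qed
  then obtain j where j: "N \<le> 2 ^ j" "2 ^ j \<le> 2 * N" by blast
  have "(4::nat) ^ j = (2 ^ j)\<^sup>2"
    by (simp add: power2_eq_square flip: power_mult_distrib)
  also have "\<dots> \<le> (2 * N)\<^sup>2" using j by (intro power_mono) auto
  finally have "4 ^ j * \<sigma> \<le> 4 * N\<^sup>2 * \<sigma>"
    by (simp add: power_mult_distrib)
  moreover have "dm_le n (4 ^ j * \<sigma>) (\<lambda>x. sum_list (map (\<lambda>w. f w x) ws))"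
    using assms j by (intro dm_le_sum_list_pow2) auto
  ultimately show ?thesis by (rule dm_le_mono[rotated])
qed

lemma dm_le_parity:
  assumes "n > 0" "A \<subseteq> {..<n}"
  shows "dm_le n (8 * n\<^sup>2) (\<lambda>x. \<Sum>i\<in>A. x i)"
proof -
  have fin: "finite A" using assms finite_subset by blast
  then obtain js where js: "set js = A" "distinct js" using finite_distinct_list by blast
  have "length js \<le> n"
    using js assms card_mono[of "{..<n}" A] by (simp add: distinct_card[symmetric])
  \<comment> \<open>A literal is one leaf; it is charged 2 to meet the requirement of
    \<open>dm_le_sum_list\<close>, whence \<open>8 = 4 * 2\<close>.\<close>
  moreover have "dm_le n 2 (\<lambda>x. x i)" if "i \<in> set js" for i
    unfolding dm_le_def
    using that js assms by (intro exI[of _ "DLit True i"]) (auto simp: dm_computes_def)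
  ultimately have "dm_le n (4 * n\<^sup>2 * 2) (\<lambda>x. sum_list (map (\<lambda>i. x i) js))"
    using assms by (intro dm_le_sum_list) auto
  moreover have "sum_list (map (\<lambda>i. x i) js) = (\<Sum>i\<in>A. x i)" for x :: "nat \<Rightarrow> bit"
    using js by (metis sum_list_distinct_conv_sum_set)
  ultimately show ?thesis by simp
qed

text \<open>Each query costs two parity formulas of size \<open>8 n^2\<close>, and
  \<open>m \<mapsto> 2 m + 16 n^2\<close> doubles \<open>m + 16 n^2\<close>; hence the additive term on the left.\<close>

lemma dm_le_truth_table_lin:
  assumes "n > 0" "set L \<subseteq> Pow {..<n}"
  shows "\<exists>m. dm_le n m (\<lambda>x. of_bool (lin L x \<in> G)) \<and> m + 16 * n\<^sup>2 \<le> 2 ^ length L * (16 * n\<^sup>2 + 2)"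
  using assms(2)
proof (induction L arbitrary: G)
  case Nil
  then show ?case
    using dm_le_const[OF assms(1), of "of_bool ([] \<in> G)"] by (intro exI[of _ 2]) (simp add: lin_def)
next
  case (Cons A L)
  obtain m1 where m1: "dm_le n m1 (\<lambda>x. of_bool (lin L x \<in> {v. 1 # v \<in> G}))"
      "m1 + 16 * n\<^sup>2 \<le> 2 ^ length L * (16 * n\<^sup>2 + 2)"
    using Cons.IH[of "{v. 1 # v \<in> G}"] Cons.prems by auto
  obtain m0 where m0: "dm_le n m0 (\<lambda>x. of_bool (lin L x \<in> {v. 0 # v \<in> G}))"
      "m0 + 16 * n\<^sup>2 \<le> 2 ^ length L * (16 * n\<^sup>2 + 2)"
    using Cons.IH[of "{v. 0 # v \<in> G}"] Cons.prems by auto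
  have "dm_le n (8 * n\<^sup>2) (\<lambda>x. \<Sum>i\<in>A. x i)"
    using Cons.prems assms(1) by (intro dm_le_parity) auto
  from dm_le_mux[OF this m1(1) m0(1)]
  have "dm_le n (2 * (8 * n\<^sup>2) + m1 + m0) (\<lambda>x. if (\<Sum>i\<in>A. x i) = 1
      then of_bool (lin L x \<in> {v. 1 # v \<in> G}) else of_bool (lin L x \<in> {v. 0 # v \<in> G}))" .
  also have "(\<lambda>x. if (\<Sum>i\<in>A. x i) = 1
      then of_bool (lin L x \<in> {v. 1 # v \<in> G}) else of_bool (lin L x \<in> {v. 0 # v \<in> G}))
      = (\<lambda>x. of_bool (lin (A # L) x \<in> G) :: bit)"
    by (auto simp: lin_def fun_eq_iff)
  finally show ?case
    using m1(2) m0(2) by (intro exI[of _ "2 * (8 * n\<^sup>2) + m1 + m0"]) simp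
qed

lemma dm_le_xor_blocks:
  assumes n: "n > 0" and ws: "set ws \<subseteq> blocks n s" "length ws \<le> N" "N > 0"
  shows "dm_le n (4 * N\<^sup>2 * (2 ^ s * (18 * n\<^sup>2))) (xor_blocks ws)"
  unfolding xor_blocks_def
proof (rule dm_le_sum_list[OF n _ _ ws(2,3)])
  have n2: "n\<^sup>2 \<ge> 1" using n by simp
  then show "2 \<le> 2 ^ s * (18 * n\<^sup>2)"
    using mult_le_mono[of 1 "2 ^ s" 2 "18 * n\<^sup>2"] by simp
  fix w assume "w \<in> set ws"
  then have w: "set (fst w) \<subseteq> Pow {..<n}" "length (fst w) = s"
    using ws subsetD[of "set ws" "blocks n s" w] by (auto simp: blocks_def words_def)
  obtain m where m: "dm_le n m (block_fun w)" "m + 16 * n\<^sup>2 \<le> 2 ^ s * (16 * n\<^sup>2 + 2)"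
    using dm_le_truth_table_lin[OF n w(1), of "snd w"] w(2) unfolding block_fun_def by auto
  \<comment> \<open>As \<open>n \<ge> 1\<close>, the 2 is absorbed by a further
    \<open>2 * n\<^sup>2\<close>.\<close>
  have "2 ^ s * (16 * n\<^sup>2 + 2) \<le> 2 ^ s * (18 * n\<^sup>2)" using n2 by (intro mult_le_mono2) linarith
  then show "dm_le n (2 ^ s * (18 * n\<^sup>2)) (block_fun w)"
    using m by (intro dm_le_mono[OF m(1)]) linarith
qed

section \<open>Choice of the dimension\<close>

text \<open>With \<open>m\<close> the integer part of \<open>x\<close>,
  \<open>x < m + 1 \<le> 2 ^ m \<le> 2 powr x\<close>. It serves to absorb the iterated logarithm
  into the logarithm.\<close>

lemma log2_le_self:
  assumes "x > 0"
  shows "log 2 x \<le> x"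
proof -
  define m where "m = nat \<lfloor>x\<rfloor>"
  have "Suc m \<le> 2 ^ m" by (simp add: Suc_le_eq)
  then have "real (Suc m) \<le> 2 ^ m" using of_nat_mono by fastforce
  moreover have "x < real (Suc m)" "real m \<le> x" using assms by (simp_all add: m_def) linarith
  moreover have "(2::real) ^ m \<le> 2 powr x"
    using calculation(3) by (simp add: powr_realpow[symmetric])
  ultimately have "x \<le> 2 powr x" by linarith
  then show ?thesis using assms by (simp add: log_le_iff)
qed

text \<open>\<open>1179648 = 12^2 * 2^10 * 2^3\<close>, from \<open>k \<le> 12 l\<close>, \<open>2^k \<le> 2^10 N l\<close> and
  \<open>l \<le> 2 log (n / \<epsilon>)\<close>, where \<open>N = n / \<epsilon>^2\<close> and \<open>l = log N\<close>.\<close>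

lemma extractor_dimension:
  assumes n: "n > 0" and \<epsilon>: "\<epsilon> > 0" "real n / \<epsilon>\<^sup>2 \<ge> 2"
  obtains k where "ext_dim n \<epsilon> \<ge> 0" "real k \<ge> ext_dim n \<epsilon> + 9" "real k \<le> ext_dim n \<epsilon> + 10"
    "32 * real (n * k) \<le> 2 ^ k * \<epsilon>\<^sup>2"
    "(real k)\<^sup>2 * 2 ^ k \<le> 1179648 * (real n / \<epsilon>\<^sup>2 * log 2 (real n / \<epsilon>) ^ 3)"
proof -
  define N where "N = real n / \<epsilon>\<^sup>2"
  define l where "l = log 2 N"
  define a where "a = ext_dim n \<epsilon>"
  \<comment> \<open>The offset 9 gives \<open>2 ^ k \<ge> 512 * (N * l)\<close>, which exceeds the
    factor \<open>384 = 32 * 12\<close> coming from \<open>k \<le> 12 * l\<close>.\<close>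
  define k where "k = nat \<lceil>a\<rceil> + 9"
  have N: "N \<ge> 2" using \<epsilon> by (simp add: N_def)
  have l: "l \<ge> 1" using N by (simp add: l_def le_log_iff)
  have a: "a = l + log 2 l" by (simp add: a_def ext_dim_def N_def l_def)
  have a0: "a \<ge> 0" using l by (simp add: a)
  have al: "a \<le> 2 * l" using log2_le_self[of l] l by (simp add: a)
  have k: "real k \<ge> a + 9" "real k \<le> a + 10"
    using a0 by (simp_all add: k_def) linarith+
  \<comment> \<open>Here \<open>a \<le> 2 * l\<close>, and the additive 10 is at most
    \<open>10 * l\<close> because \<open>l \<ge> 1\<close>.\<close>
  have k12: "real k \<le> 12 * l" using k al l by linarith
  have pa: "2 powr a = N * l" using N l by (simp add: a l_def powr_add)
  have pk: "2 ^ k = (2 :: real) powr real k" by (simp add: powr_realpow)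
  have up: "2 ^ k \<le> 1024 * (N * l)"
  proof -
    have "(2::real) powr real k \<le> 2 powr (a + 10)" using k by (intro powr_mono) auto
    also have "\<dots> = 1024 * (N * l)" by (simp add: powr_add pa)
    finally show ?thesis by (simp add: pk)
  qed
  have lo: "512 * (N * l) \<le> 2 ^ k"
  proof -
    have "512 * (N * l) = 2 powr (a + 9)" by (simp add: powr_add pa)
    also have "\<dots> \<le> (2::real) powr real k" using k by (intro powr_mono) auto
    finally show ?thesis by (simp add: pk)
  qed
  have nN: "real n = N * \<epsilon>\<^sup>2" using \<epsilon> by (simp add: N_def)
  have "32 * real (n * k) \<le> 384 * (real n * l)"
    using mult_left_mono[OF k12, of "32 * real n"] by simp
  also have "\<dots> \<le> 512 * (N * l) * \<epsilon>\<^sup>2" using l N by (simp add: nN mult_ac)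
  also have "\<dots> \<le> 2 ^ k * \<epsilon>\<^sup>2" using lo by (intro mult_right_mono) auto
  finally have ext: "32 * real (n * k) \<le> 2 ^ k * \<epsilon>\<^sup>2" .
  define q where "q = log 2 (real n / \<epsilon>)"
  have l2: "l \<le> 2 * q"
  proof -
    have "N \<le> (real n / \<epsilon>)\<^sup>2"
    proof -
      have "real n \<le> (real n)\<^sup>2" using n by (simp add: power2_eq_square)
      then show ?thesis by (simp add: N_def power_divide divide_right_mono)
    qed
    then have "l \<le> log 2 ((real n / \<epsilon>)\<^sup>2)" unfolding l_def using N by (intro log_mono) auto
    also have "\<dots> = 2 * q" using n \<epsilon> by (simp add: q_def log_nat_power)
    finally show ?thesis .
  qed
  have "(real k)\<^sup>2 * 2 ^ k \<le> (12 * l)\<^sup>2 * (1024 * (N * l))"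
    using k12 up l by (intro mult_mono power_mono) auto
  also have "\<dots> = 147456 * (N * l ^ 3)"
    by (simp add: power2_eq_square power3_eq_cube)
  also have "\<dots> \<le> 147456 * (N * (2 * q) ^ 3)"
    using l l2 N by (intro mult_left_mono power_mono) auto
  also have "\<dots> = 1179648 * (N * q ^ 3)"
    by (simp add: power_mult_distrib)
  finally show ?thesis
    using that[of k] a0 k ext by (simp add: a_def N_def q_def)
qed

text \<open>For \<open>k \<le> n\<close> the random choice is used, with \<open>d = k\<close>. For
  larger \<open>k\<close> the extractor property is vacuous, and the zero function or a single
  monomial has degree \<open>d\<close>.\<close>

lemma exists_low_degree_extractor:
  assumes n: "n > 0" and \<epsilon>: "\<epsilon> > 0" "32 * real (n * k) \<le> 2 ^ k * \<epsilon>\<^sup>2"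
    and k: "k \<ge> 2" and d: "d \<le> k" "d \<le> n" "k \<le> n \<Longrightarrow> d = k"
  obtains ws where "set ws \<subseteq> blocks n d" "length ws \<le> n * k + 1"
    "affine_extractor n k \<epsilon> (xor_blocks ws)" "f2_degree n (xor_blocks ws) = d"
proof (cases "k \<le> n")
  case True
  then have [simp]: "d = k" using d by simp
  obtain ws where ws: "ws \<in> words (blocks n k) (n * k)"
    "affine_extractor n k \<epsilon> (xor_blocks ws)" "affine_extractor n k \<epsilon> (xor_blocks (monomial_block k # ws))"
    using exists_extractor_xor_blocks[OF n k \<epsilon>] by blast
  then have "set ws \<subseteq> blocks n k" "length ws = n * k" by (auto simp: words_def)
  then show ?thesis
    using f2_degree_xor_monomial_block[of d n ws] that[of ws] that[of "monomial_block k # ws"] ws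
      monomial_block_in_blocks[OF d(2)] d(2) by auto
next
  case False
  then have "affine_extractor n k \<epsilon> f" for f
    using affine_subspace_dim_le by (auto simp: affine_extractor_def)
  then show ?thesis
    using f2_degree_xor_monomial_block[of d n "[]"] that[of "[]"] that[of "[monomial_block d]"]
      monomial_block_in_blocks[OF d(2)] d(2) by auto
qed

section \<open>Assembling dimension, degree and sizes\<close>

theorem theoremA6:
  shows "\<exists>(n0::nat) (C::real). C > 0 \<and>
    (\<forall>n>n0. \<forall>\<epsilon>::real. \<epsilon> > 0 \<longrightarrow> real n / \<epsilon>\<^sup>2 \<ge> 2 \<longrightarrow>
      (\<exists>(k::nat) (f :: (nat \<Rightarrow> bit) \<Rightarrow> bit).
         \<bar>real k - ext_dim n \<epsilon>\<bar> \<le> C \<and>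
         affine_extractor n k \<epsilon> f \<and>
         (real (f2_degree n f) \<le> ext_dim n \<epsilon> + C \<and>
          (ext_dim n \<epsilon> \<le> real n \<longrightarrow> real (f2_degree n f) \<ge> ext_dim n \<epsilon> - C)) \<and>
         (\<exists>K. xax_computes n K f \<and>
              real (xax_size K) \<le> C * ((real n / \<epsilon>)\<^sup>2 * (log 2 (real n / \<epsilon>)) ^ 3)) \<and>
         (\<exists>F. dm_computes n F f \<and>
              real (dm_size F) \<le> C * (real n ^ 5 / \<epsilon>\<^sup>2 * (log 2 (real n / \<epsilon>)) ^ 3))))"
proof (rule exI[of _ 0], rule exI[of _ "10 ^ 9"], intro conjI allI impI)
  fix n :: nat and \<epsilon> :: real
  assume n: "n > 0" and \<epsilon>: "\<epsilon> > 0" "real n / \<epsilon>\<^sup>2 \<ge> 2"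
  define a where "a = ext_dim n \<epsilon>"
  define R where "R = real n / \<epsilon>\<^sup>2 * log 2 (real n / \<epsilon>) ^ 3"
  obtain k where k: "a \<ge> 0" "real k \<ge> a + 9" "real k \<le> a + 10" "32 * real (n * k) \<le> 2 ^ k * \<epsilon>\<^sup>2"
    "(real k)\<^sup>2 * 2 ^ k \<le> 1179648 * R"
    using extractor_dimension[OF n \<epsilon>] unfolding a_def R_def by blast
  \<comment> \<open>The sign of the logarithmic factor is read off from the bound on
    \<open>k\<close>, whose left side is nonnegative.\<close>
  have "0 \<le> 1179648 * R" using k(5) by (rule order_trans[rotated]) simp
  then have R0: "R \<ge> 0" by simp
  have k2: "k \<ge> 2" using k by linarith
  \<comment> \<open>No degree exceeds \<open>n\<close>. When \<open>k\<close> does not fit, the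
    integer part of \<open>a\<close>, cut off at \<open>n\<close>, is still within 1 of
    \<open>a\<close> as soon as \<open>a \<le> n\<close>.\<close>
  define d where "d = (if k \<le> n then k else min n (nat \<lfloor>a\<rfloor>))"
  have da: "real d \<le> a + 10" "a \<le> real n \<Longrightarrow> a - 1 \<le> real d"
    using k(1-3) unfolding d_def by (auto split: if_splits simp: min_def)
  have d: "d \<le> k" "d \<le> n" "k \<le> n \<Longrightarrow> d = k"
    using k(1,2) unfolding d_def by (auto split: if_splits simp: min_def)
  obtain ws where ws: "set ws \<subseteq> blocks n d" "length ws \<le> n * k + 1"
    "affine_extractor n k \<epsilon> (xor_blocks ws)" "f2_degree n (xor_blocks ws) = d"
    using exists_low_degree_extractor[OF n \<epsilon>(1) k(4) k2 d] by blast
  have nk: "n * k + 1 \<le> 2 * (n * k)" "1 \<le> k" using n k2 by (auto simp: Suc_le_eq)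
  have len: "length ws \<le> 2 * (n * k)" using ws nk by linarith
  have pow: "(2::nat) ^ d \<le> 2 ^ k" using d by (intro power_increasing) auto

  obtain K where K: "xax_computes n K (xor_blocks ws)" "xax_size K \<le> length ws * (2 ^ d * (d + 1)) + 1"
    using xax_le_xor_blocks[OF ws(1)] unfolding xax_le_def by blast
  note K(2)
  \<comment> \<open>\<open>d + 1 \<le> 2 * k\<close> gives the factor 4, and the top gate is
    absorbed by one more \<open>n * k * (2 ^ k * k)\<close>.\<close>
  also have "length ws * (2 ^ d * (d + 1)) + 1 \<le> 2 * (n * k) * (2 ^ k * (2 * k)) + n * k * (2 ^ k * k)"
  proof (rule add_mono)
    show "length ws * (2 ^ d * (d + 1)) \<le> 2 * (n * k) * (2 ^ k * (2 * k))"
      using len pow d nk by (intro mult_le_mono) auto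
    show "1 \<le> n * k * (2 ^ k * k)" using n nk by (simp add: Suc_le_eq)
  qed
  also have "\<dots> = 5 * (n * (k\<^sup>2 * 2 ^ k))" by (simp add: power2_eq_square)
  finally have "real (xax_size K) \<le> real (5 * (n * (k\<^sup>2 * 2 ^ k)))" by (rule of_nat_mono)
  also have "\<dots> = 5 * real n * ((real k)\<^sup>2 * 2 ^ k)" by simp
  also have "\<dots> \<le> 5 * real n * (1179648 * R)" using k(5) by (intro mult_left_mono) auto
  also have "\<dots> \<le> 10 ^ 9 * (real n * R)"
    using R0 by (simp add: mult_right_mono mult.commute)
  also have "real n * R = (real n / \<epsilon>)\<^sup>2 * log 2 (real n / \<epsilon>) ^ 3"
    by (simp add: R_def power2_eq_square)
  finally have xax: "real (xax_size K) \<le> 10 ^ 9 * ((real n / \<epsilon>)\<^sup>2 * log 2 (real n / \<epsilon>) ^ 3)" .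

  obtain F where F: "dm_computes n F (xor_blocks ws)" "dm_size F \<le> 4 * (2 * (n * k))\<^sup>2 * (2 ^ d * (18 * n\<^sup>2))"
    using dm_le_xor_blocks[OF n ws(1) len] n k2 unfolding dm_le_def by auto
  note F(2)
  also have "4 * (2 * (n * k))\<^sup>2 * (2 ^ d * (18 * n\<^sup>2)) \<le> 4 * (2 * (n * k))\<^sup>2 * (2 ^ k * (18 * n\<^sup>2))"
    using pow by simp
  also have "\<dots> = 288 * (n ^ 4 * (k\<^sup>2 * 2 ^ k))"
    by (simp add: power2_eq_square power4_eq_xxxx)
  finally have "real (dm_size F) \<le> real (288 * (n ^ 4 * (k\<^sup>2 * 2 ^ k)))" by (rule of_nat_mono)
  also have "\<dots> = 288 * real n ^ 4 * ((real k)\<^sup>2 * 2 ^ k)" by simp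
  also have "\<dots> \<le> 288 * real n ^ 4 * (1179648 * R)" using k(5) by (intro mult_left_mono) auto
  \<comment> \<open>\<open>288 * 1179648\<close> is the largest constant to arise and lies below
    \<open>10 ^ 9\<close>.\<close>
  also have "\<dots> \<le> 10 ^ 9 * (real n ^ 4 * R)"
    using R0 by (simp add: mult_right_mono mult.commute)
  also have "real n ^ 4 * R = real n ^ 5 / \<epsilon>\<^sup>2 * log 2 (real n / \<epsilon>) ^ 3"
    by (simp add: R_def eval_nat_numeral)
  finally have dm: "real (dm_size F) \<le> 10 ^ 9 * (real n ^ 5 / \<epsilon>\<^sup>2 * log 2 (real n / \<epsilon>) ^ 3)" .

  show "\<exists>(k::nat) (f :: (nat \<Rightarrow> bit) \<Rightarrow> bit).
         \<bar>real k - ext_dim n \<epsilon>\<bar> \<le> 10 ^ 9 \<and>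
         affine_extractor n k \<epsilon> f \<and>
         (real (f2_degree n f) \<le> ext_dim n \<epsilon> + 10 ^ 9 \<and>
          (ext_dim n \<epsilon> \<le> real n \<longrightarrow> real (f2_degree n f) \<ge> ext_dim n \<epsilon> - 10 ^ 9)) \<and>
         (\<exists>K. xax_computes n K f \<and>
              real (xax_size K) \<le> 10 ^ 9 * ((real n / \<epsilon>)\<^sup>2 * (log 2 (real n / \<epsilon>)) ^ 3)) \<and>
         (\<exists>F. dm_computes n F f \<and>
              real (dm_size F) \<le> 10 ^ 9 * (real n ^ 5 / \<epsilon>\<^sup>2 * (log 2 (real n / \<epsilon>)) ^ 3))"
    unfolding a_def[symmetric]
    by (rule exI[of _ k], rule exI[of _ "xor_blocks ws"], intro conjI impI exI[of _ K] exI[of _ F])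
      (use k(1-3) da ws K F xax dm in auto)
qed simp

end
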